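(* Let $\phi\in\mathrm{J}_0$. Then $\phi$ has bounded growth if and only if the Baum-Bott index $\mathrm{BB}(\phi)$ belongs to $\mathbb{C}$. In this case, up to birational conjugacy, $\phi$ is either of type $\mathfrak{a}$, or of linear type $\mathfrak{b}$, that is $(bx,y)$ with $b\in\mathbb{C}^*$, or an involution $\left(\frac{F(y)}{x},y\right)$ of type $\mathfrak{c}$.
   Context: $\mathrm{Bir}(\mathbb{P}^2)$ is the group of birational self-maps of $\mathbb{P}^2(\mathbb{C})$; the degree $\deg\phi$ of $\phi=(\phi_0:\phi_1:\phi_2)$ is the common degree of the homogeneous polynomials $\phi_i$, taken without common factor. $\phi$ has bounded growth if the sequence $(\deg\phi^n)_n$ is bounded. In an affine chart $(x,y)$, $\mathrm{J}_0\simeq\mathrm{PGL}_2(\mathbb{C}(y))$ is the group of birational maps preserving the fibration $y=\text{const}$ fibre by fibre, i.e. maps $\phi=\left(\frac{A(y)x+B(y)}{C(y)x+D(y)},y\right)$ with associated matrix $\mathrm{M}_\phi=\begin{bmatrix}A&B\\C&D\end{bmatrix}\in\mathrm{PGL}_2(\mathbb{C}[y])$. The Baum-Bott index of $\phi$ is $\mathrm{BB}(\phi)=\frac{(\mathrm{tr}\,\mathrm{M}_\phi)^2}{\det\mathrm{M}_\phi}\in\mathbb{C}(y)$. Up to birational conjugacy every element of $\mathrm{J}_0$ has one of the types: $\mathfrak{a}$: $(x+a(y),y)$ with $a\in\mathbb{C}(y)$; $\mathfrak{b}$: $(b(y)x,y)$ with $b\in\mathbb{C}(y)^*$; $\mathfrak{c}$: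 $\left(\frac{c(y)x+F(y)}{x+c(y)},y\right)$ with $c,F\in\mathbb{C}[y]$, $F$ not a square. "Being of a type" is understood up to birational conjugacy. *)

theory Defs
  imports
    "HOL-Computational_Algebra.Computational_Algebra"
    "HOL-Computational_Algebra.Field_as_Ring"
begin

section \<open>Polynomials in three variables\<close>

text \<open>
  The ring \<open>\<complex>[X,Y,Z]\<close> is the iterated polynomial ring \<open>\<complex>[Z][Y][X]\<close>: the outermost
  variable is \<open>X\<close>, and the coefficient of \<open>X\<^sup>i Y\<^sup>j Z\<^sup>k\<close> in \<open>p\<close> is
  \<^term>\<open>coeff (coeff (coeff p i) j) k\<close>.
\<close>

type_synonym poly3 = "complex poly poly poly"
type_synonym triple = "poly3 \<times> poly3 \<times> poly3"

definition cst :: "complex \<Rightarrow> poly3" where "cst c = [:[:[:c:]:]:]"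
definition varX :: poly3 where "varX = [:0, 1:]"
definition varY :: poly3 where "varY = [:[:0, 1:]:]"
definition varZ :: poly3 where "varZ = [:[:[:0, 1:]:]:]"

definition homog :: "nat \<Rightarrow> poly3 \<Rightarrow> bool" where
  "homog d p \<longleftrightarrow> (\<forall>i j k. coeff (coeff (coeff p i) j) k \<noteq> 0 \<longrightarrow> i + j + k = d)"

text \<open>\<open>subst3 (a, b, c) p = p(a, b, c)\<close>, by evaluating \<open>Z\<close>, \<open>Y\<close>, \<open>X\<close> in turn.\<close>

fun subst3 :: "triple \<Rightarrow> poly3 \<Rightarrow> poly3" where
  "subst3 (a, b, c) p =
     poly (map_poly (\<lambda>q. poly (map_poly (\<lambda>r. poly (map_poly cst r) c) q) b) p) a"

section \<open>Birational self-maps of the projective plane\<close>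

text \<open>
  A rational self-map \<open>(f\<^sub>0 : f\<^sub>1 : f\<^sub>2)\<close> of the plane is given by homogeneous polynomials of
  the same degree, not all zero and possibly with a common factor; two triples define the
  same map iff they are proportional over \<open>\<complex>(X,Y,Z)\<close>.
\<close>

fun homog_triple :: "nat \<Rightarrow> triple \<Rightarrow> bool" where
  "homog_triple d (f0, f1, f2) \<longleftrightarrow>
     homog d f0 \<and> homog d f1 \<and> homog d f2 \<and> (f0, f1, f2) \<noteq> (0, 0, 0)"

fun same_map :: "triple \<Rightarrow> triple \<Rightarrow> bool" where
  "same_map (f0, f1, f2) (g0, g1, g2) \<longleftrightarrow>
     (f0, f1, f2) \<noteq> (0, 0, 0) \<and> (g0, g1, g2) \<noteq> (0, 0, 0) \<and>
     f0 * g1 = f1 * g0 \<and> f0 * g2 = f2 * g0 \<and> f1 * g2 = f2 * g1"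

fun comp_triple :: "triple \<Rightarrow> triple \<Rightarrow> triple" where
  "comp_triple (f0, f1, f2) g = (subst3 g f0, subst3 g f1, subst3 g f2)"

definition id_triple :: triple where "id_triple = (varX, varY, varZ)"

definition birational :: "triple \<Rightarrow> bool" where
  "birational f \<longleftrightarrow> (\<exists>d. homog_triple d f) \<and>
     (\<exists>g e. homog_triple e g \<and>
        same_map (comp_triple f g) id_triple \<and> same_map (comp_triple g f) id_triple)"

fun no_common_factor :: "triple \<Rightarrow> bool" where
  "no_common_factor (f0, f1, f2) \<longleftrightarrow>
     (\<forall>h. h dvd f0 \<and> h dvd f1 \<and> h dvd f2 \<longrightarrow> is_unit h)"

subsection \<open>Substitution is a ring homomorphism\<close>

definition rhom :: "('a::comm_ring_1 \<Rightarrow> 'b::comm_ring_1) \<Rightarrow> bool" where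
  "rhom h \<longleftrightarrow> h 0 = 0 \<and> h 1 = 1 \<and> (\<forall>x y. h (x + y) = h x + h y) \<and> (\<forall>x y. h (x * y) = h x * h y)"

lemma rhomD:
  assumes "rhom h"
  shows "h 0 = 0" "h 1 = 1" "h (x + y) = h x + h y" "h (x * y) = h x * h y"
  using assms by (auto simp: rhom_def)

lemma rhom_sum: "rhom h \<Longrightarrow> h (sum f A) = (\<Sum>x\<in>A. h (f x))"
  by (induction A rule: infinite_finite_induct) (auto simp: rhomD)

lemma rhom_power: "rhom h \<Longrightarrow> h (x ^ n) = h x ^ n"
  by (induction n) (auto simp: rhomD)

lemma rhom_map_poly:
  assumes "rhom h" shows "rhom (map_poly h)"
proof -
  note h = rhomD[OF assms]
  have "map_poly h (p * q) = map_poly h p * map_poly h q" for p q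
    by (rule poly_eqI) (simp add: coeff_map_poly h coeff_mult rhom_sum[OF assms])
  moreover have "map_poly h (p + q) = map_poly h p + map_poly h q" for p q
    by (rule poly_eqI) (simp add: coeff_map_poly h)
  ultimately show ?thesis using h by (simp add: rhom_def)
qed

lemma rhom_poly_map:
  assumes "rhom h" shows "rhom (\<lambda>p. poly (map_poly h p) a)"
  using rhomD[OF rhom_map_poly[OF assms]] by (simp add: rhom_def)

lemma rhom_cst: "rhom cst"
  by (simp add: rhom_def cst_def one_pCons)

lemma rhom_const: "rhom (\<lambda>c. [:c:])"
  by (simp add: rhom_def one_pCons)

lemma rhom_subst3: "rhom (subst3 g)"
  by (cases g) (auto simp del: subst3.simps simp: subst3.simps[abs_def]
      intro!: rhom_poly_map rhom_cst)

lemma poly_map_poly_altdef: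
  fixes h :: "'a::comm_ring_1 \<Rightarrow> 'b::comm_ring_1"
  assumes "h 0 = 0"
  shows "poly (map_poly h p) a = (\<Sum>i\<le>degree p. h (coeff p i) * a ^ i)"
proof -
  have "poly (map_poly h p) a = (\<Sum>i\<le>degree (map_poly h p). h (coeff p i) * a ^ i)"
    by (subst poly_altdef) (simp add: coeff_map_poly assms)
  also have "\<dots> = (\<Sum>i\<le>degree p. h (coeff p i) * a ^ i)"
  proof (rule sum.mono_neutral_left)
    show "{..degree (map_poly h p)} \<subseteq> {..degree p}" by (simp add: map_poly_degree_leq)
    show "\<forall>i\<in>{..degree p} - {..degree (map_poly h p)}. h (coeff p i) * a ^ i = 0"
    proof
      fix i assume "i \<in> {..degree p} - {..degree (map_poly h p)}"
      then have "coeff (map_poly h p) i = 0" by (intro coeff_eq_0) auto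
      then show "h (coeff p i) * a ^ i = 0" by (simp add: coeff_map_poly assms)
    qed
  qed auto
  finally show ?thesis .
qed

lemma rhom_poly_map_comp:
  fixes k :: "'a::comm_ring_1 \<Rightarrow> 'b::comm_ring_1"
  assumes "rhom h" "k 0 = 0"
  shows "h (poly (map_poly k p) a) = poly (map_poly (\<lambda>x. h (k x)) p) (h a)"
  using assms by (simp add: poly_map_poly_altdef rhomD rhom_sum rhom_power)

lemma subst3_cst: "subst3 g (cst c) = cst c"
  by (cases g) (simp add: cst_def map_poly_pCons)

lemma subst3_vars:
  "subst3 (a, b, c) varX = a" "subst3 (a, b, c) varY = b" "subst3 (a, b, c) varZ = c"
  using rhomD(1,2)[OF rhom_cst]
    rhomD(1,2)[OF rhom_poly_map[OF rhom_cst], of c]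
    rhomD(1,2)[OF rhom_poly_map[OF rhom_poly_map[OF rhom_cst]], of c b]
  by (simp_all add: varX_def varY_def varZ_def map_poly_pCons)

lemma subst3_subst3: "subst3 g (subst3 f p) = subst3 (comp_triple f g) p"
proof (cases f)
  case (fields a b c)
  show ?thesis unfolding fields
    by (simp add: rhom_poly_map_comp[OF rhom_subst3] rhomD(1)[OF rhom_cst] subst3_cst)
qed

lemma comp_triple_assoc:
  "comp_triple (comp_triple f g) h = comp_triple f (comp_triple g h)"
  by (cases f) (simp add: subst3_subst3)

lemma comp_id_left: "comp_triple id_triple f = f"
  by (cases f) (simp add: id_triple_def subst3_vars del: subst3.simps)

lemma poly_map_poly_const:
  fixes p :: "'a::comm_ring_1 poly"
  shows "poly (map_poly (\<lambda>c. [:c:]) p) [:0, 1:] = p"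
  by (simp flip: pcompose_altdef add: pcompose_idR)

lemma subst3_id: "subst3 id_triple p = p"
proof -
  have 1: "poly (map_poly cst r) varZ = [:[:r:]:]" for r
    using rhom_poly_map_comp[of "\<lambda>c. [:[:c:]:]" "\<lambda>c. [:c:]" r "[:0, 1:]"]
    by (simp add: rhom_def one_pCons poly_map_poly_const cst_def[abs_def] varZ_def)
  have 2: "poly (map_poly (\<lambda>r. [:[:r:]:]) q) varY = [:q:]" for q
    using rhom_poly_map_comp[of "\<lambda>c. [:c:]" "\<lambda>c. [:c:]" q "[:0, 1:]"]
    by (simp only: poly_map_poly_const rhom_const varY_def coeff_0 pCons_0_0 simp_thms)
  show ?thesis by (simp add: id_triple_def 1 2 varX_def poly_map_poly_const)
qed

lemma comp_id_right: "comp_triple f id_triple = f"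
  by (cases f) (simp add: subst3_id del: subst3.simps)


subsection \<open>Homogeneous polynomials\<close>

lemma homog_0 [simp]: "homog d 0"
  by (simp add: homog_def)

lemma homog_add: "homog d p \<Longrightarrow> homog d q \<Longrightarrow> homog d (p + q)"
  unfolding homog_def by (metis add_0 coeff_add)

lemma homog_sum: "(\<And>i. i \<in> A \<Longrightarrow> homog d (f i)) \<Longrightarrow> homog d (sum f A)"
  by (induction A rule: infinite_finite_induct) (auto intro: homog_add)

lemma homog_mult:
  assumes "homog d p" "homog e q" shows "homog (d + e) (p * q)"
  unfolding homog_def
proof (intro allI impI)
  fix i j k assume *: "coeff (coeff (coeff (p * q) i) j) k \<noteq> 0"
  have "coeff (coeff (coeff (p * q) i) j) k =
    (\<Sum>i'\<le>i. \<Sum>j'\<le>j. \<Sum>k'\<le>k. coeff (coeff (coeff p i') j') k' *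
        coeff (coeff (coeff q (i - i')) (j - j')) (k - k'))"
    by (simp add: coeff_mult coeff_sum)
  with * obtain i' where "i' \<le> i" "(\<Sum>j'\<le>j. \<Sum>k'\<le>k. coeff (coeff (coeff p i') j') k' *
        coeff (coeff (coeff q (i - i')) (j - j')) (k - k')) \<noteq> 0"
    by (metis (no_types, lifting) atMost_iff sum.not_neutral_contains_not_neutral)
  moreover from this obtain j' where "j' \<le> j" "(\<Sum>k'\<le>k. coeff (coeff (coeff p i') j') k' *
        coeff (coeff (coeff q (i - i')) (j - j')) (k - k')) \<noteq> 0"
    by (metis (no_types, lifting) atMost_iff sum.not_neutral_contains_not_neutral)
  moreover from this obtain k' where "k' \<le> k" "coeff (coeff (coeff p i') j') k' *
        coeff (coeff (coeff q (i - i')) (j - j')) (k - k') \<noteq> 0"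
    by (metis (no_types, lifting) atMost_iff sum.not_neutral_contains_not_neutral)
  moreover from this have "i' + j' + k' = d" "(i - i') + (j - j') + (k - k') = e"
    using assms unfolding homog_def by (metis mult_eq_0_iff)+
  ultimately show "i + j + k = d + e" by linarith
qed

lemma homog_cst: "homog 0 (cst c)"
  by (auto simp: homog_def cst_def coeff_pCons split: nat.splits)

lemma homog_vars: "homog 1 varX" "homog 1 varY" "homog 1 varZ"
proof -
  have *: "coeff [:0, a:] i = (if i = 1 then a else 0)"
    "coeff [:a:] i = (if i = 0 then a else 0)" for a :: "'a::zero" and i
    by (auto simp: coeff_pCons split: nat.splits)
  show "homog 1 varX" unfolding homog_def varX_def by (auto simp: * split: if_splits)
  show "homog 1 varY" unfolding homog_def varY_def by (auto simp: * split: if_splits)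
  show "homog 1 varZ" unfolding homog_def varZ_def by (auto simp: * split: if_splits)
qed

lemma homog_1: "homog 0 1"
  using homog_cst[of 1] rhomD(2)[OF rhom_cst] by simp

lemma homog_power: "homog d p \<Longrightarrow> homog (n * d) (p ^ n)"
  by (induction n) (auto intro: homog_mult homog_1)

lemma homog_poly_map:
  fixes p :: "'a::comm_ring_1 poly"
  assumes "h 0 = 0" "homog e a"
    "\<And>i. coeff p i \<noteq> 0 \<Longrightarrow> \<exists>n. homog n (h (coeff p i)) \<and> n + i * e = N"
  shows "homog N (poly (map_poly h p) a)"
  unfolding poly_map_poly_altdef[of h, OF assms(1)]
proof (rule homog_sum)
  fix i
  show "homog N (h (coeff p i) * a ^ i)"
  proof (cases "coeff p i = 0")
    case False
    then obtain n where "homog n (h (coeff p i))" "n + i * e = N" using assms(3) by blast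
    then show ?thesis using homog_mult[OF _ homog_power[OF assms(2)]] by blast
  qed (simp add: assms)
qed

lemma poly_neq_0D: "(p :: 'a::comm_ring_1 poly) \<noteq> 0 \<Longrightarrow> \<exists>i. coeff p i \<noteq> 0"
  by (metis leading_coeff_0_iff)

lemma homog_subst3:
  assumes "homog d p" "homog e a" "homog e b" "homog e c"
  shows "homog (d * e) (subst3 (a, b, c) p)"
proof -
  have 1: "homog (n * e) (poly (map_poly cst r) c)" if "\<And>k. coeff r k \<noteq> 0 \<Longrightarrow> k = n" for n r
    using that assms rhomD(1)[OF rhom_cst]
    by (intro homog_poly_map[where e = e]) (force intro: homog_cst)+
  have 2: "homog (n * e) (poly (map_poly (\<lambda>r. poly (map_poly cst r) c) q) b)"
    if *: "\<And>j k. coeff (coeff q j) k \<noteq> 0 \<Longrightarrow> j + k = n" for n q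
  proof (intro homog_poly_map[where e = e])
    fix j assume "coeff q j \<noteq> 0"
    with * have "j \<le> n" by (metis le_add1 poly_neq_0D)
    have "homog ((n - j) * e) (poly (map_poly cst (coeff q j)) c)"
      by (intro 1) (use * in force)
    moreover have "(n - j) * e + j * e = n * e"
      using \<open>j \<le> n\<close> by (simp flip: add_mult_distrib)
    ultimately show "\<exists>m. homog m (poly (map_poly cst (coeff q j)) c) \<and> m + j * e = n * e" by blast
  qed (use assms in auto)
  show ?thesis unfolding subst3.simps
  proof (intro homog_poly_map[where e = e])
    fix i assume "coeff p i \<noteq> 0"
    then obtain j k where "coeff (coeff (coeff p i) j) k \<noteq> 0" by (metis poly_neq_0D)
    then have "i + j + k = d" using assms(1) by (auto simp: homog_def)
    then have "i \<le> d" by simp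
    have "homog ((d - i) * e)
        (poly (map_poly (\<lambda>r. poly (map_poly cst r) c) (coeff p i)) b)"
      by (intro 2) (use assms(1) in \<open>force simp: homog_def\<close>)
    moreover have "(d - i) * e + i * e = d * e"
      using \<open>i \<le> d\<close> by (simp flip: add_mult_distrib)
    ultimately show "\<exists>m. homog m (poly (map_poly (\<lambda>r. poly (map_poly cst r) c) (coeff p i)) b)
        \<and> m + i * e = d * e" by blast
  qed (use assms in auto)
qed

lemma scale_poly_map:
  fixes p :: "'a::comm_ring_1 poly" and t :: "'b::comm_ring_1"
  assumes "h 0 = 0" "h' 0 = 0"
    "\<And>i. coeff p i \<noteq> 0 \<Longrightarrow> \<exists>n. h' (coeff p i) = t ^ n * h (coeff p i) \<and> n + i = N"
  shows "poly (map_poly h' p) (t * a) = t ^ N * poly (map_poly h p) a"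
  unfolding poly_map_poly_altdef[of h, OF assms(1)] poly_map_poly_altdef[of h', OF assms(2)]
    sum_distrib_left
proof (rule sum.cong)
  fix i
  show "h' (coeff p i) * (t * a) ^ i = t ^ N * (h (coeff p i) * a ^ i)"
  proof (cases "coeff p i = 0")
    case False
    then obtain n where "h' (coeff p i) = t ^ n * h (coeff p i)" "n + i = N" using assms(3) by blast
    then show ?thesis by (auto simp: power_mult_distrib power_add algebra_simps)
  qed (simp add: assms)
qed auto

lemma subst3_scale:
  assumes "homog d p"
  shows "subst3 (t * a, t * b, t * c) p = t ^ d * subst3 (a, b, c) p"
proof -
  have 1: "poly (map_poly cst r) (t * c) = t ^ n * poly (map_poly cst r) c"
    if "\<And>k. coeff r k \<noteq> 0 \<Longrightarrow> k = n" for n r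
    using that rhomD(1)[OF rhom_cst] by (intro scale_poly_map) force+
  have 2: "poly (map_poly (\<lambda>r. poly (map_poly cst r) (t * c)) q) (t * b) =
      t ^ n * poly (map_poly (\<lambda>r. poly (map_poly cst r) c) q) b"
    if *: "\<And>j k. coeff (coeff q j) k \<noteq> 0 \<Longrightarrow> j + k = n" for n q
  proof (intro scale_poly_map)
    fix j assume "coeff q j \<noteq> 0"
    with * have "j \<le> n" by (metis le_add1 poly_neq_0D)
    have "poly (map_poly cst (coeff q j)) (t * c) = t ^ (n - j) * poly (map_poly cst (coeff q j)) c"
      by (intro 1) (use * in force)
    then show "\<exists>m. poly (map_poly cst (coeff q j)) (t * c) =
        t ^ m * poly (map_poly cst (coeff q j)) c \<and> m + j = n"
      using \<open>j \<le> n\<close> by (intro exI[of _ "n - j"]) auto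
  qed auto
  show ?thesis unfolding subst3.simps
  proof (intro scale_poly_map)
    fix i assume "coeff p i \<noteq> 0"
    then obtain j k where "coeff (coeff (coeff p i) j) k \<noteq> 0" by (metis poly_neq_0D)
    then have "i + j + k = d" using assms(1) by (auto simp: homog_def)
    then have "i \<le> d" by simp
    have "poly (map_poly (\<lambda>r. poly (map_poly cst r) (t * c)) (coeff p i)) (t * b) =
      t ^ (d - i) * poly (map_poly (\<lambda>r. poly (map_poly cst r) c) (coeff p i)) b"
      by (intro 2) (use assms(1) in \<open>force simp: homog_def\<close>)
    then show "\<exists>m. poly (map_poly (\<lambda>r. poly (map_poly cst r) (t * c)) (coeff p i)) (t * b) =
      t ^ m * poly (map_poly (\<lambda>r. poly (map_poly cst r) c) (coeff p i)) b \<and> m + i = d"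
      using \<open>i \<le> d\<close> by (intro exI[of _ "d - i"]) auto
  qed auto
qed

subsection \<open>Composition of triples\<close>

declare subst3.simps [simp del]

lemma same_map_refl: "f \<noteq> (0, 0, 0) \<Longrightarrow> same_map f f"
  by (cases f) (auto simp: mult.commute)

lemma same_map_sym: "same_map f g \<Longrightarrow> same_map g f"
  by (cases f; cases g) (auto simp: mult.commute)

lemma same_map_trans:
  assumes "same_map f g" "same_map g h" shows "same_map f h"
proof -
  obtain f0 f1 f2 g0 g1 g2 h0 h1 h2
    where eqs: "f = (f0, f1, f2)" "g = (g0, g1, g2)" "h = (h0, h1, h2)"
    by (metis prod_cases3)
  have *: "a * t = b * s" if eq: "a * y = b * x" "x * t = y * s" "a * w = c * x" "b * w = c * y"
    and nz: "(x, y, w) \<noteq> (0, 0, 0)" for a b c x y w s t :: poly3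
  proof -
    have "x * (a * t) = a * (x * t)" "y * (a * t) = (a * y) * t" "w * (a * t) = (a * w) * t"
      by (simp_all add: algebra_simps)
    moreover have "a * (x * t) = (a * y) * s" by (simp add: eq(2) mult.assoc)
    moreover have "(a * y) * s = x * (b * s)" by (simp add: eq(1) algebra_simps)
    moreover have "(a * y) * t = b * (x * t)" by (simp add: eq(1) mult.assoc)
    moreover have "b * (x * t) = b * (y * s)" by (simp only: eq(2))
    moreover have "b * (y * s) = y * (b * s)" by (simp add: algebra_simps)
    moreover have "(a * w) * t = c * (x * t)" by (simp add: eq(3) mult.assoc)
    moreover have "c * (x * t) = (c * y) * s" by (simp add: eq(2) mult.assoc)
    moreover have "(c * y) * s = w * (b * s)" by (simp add: eq(4)[symmetric] algebra_simps)
    ultimately show ?thesis using nz by auto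
  qed
  show ?thesis
    using assms unfolding eqs same_map.simps
    apply (intro conjI)
        apply blast
       apply blast
    subgoal by (rule *[of f0 g1 f1 g0 h1 h0 g2 f2]) auto
    subgoal by (rule *[of f0 g2 f2 g0 h2 h0 g1 f1]) (auto simp: mult.commute)
    subgoal by (rule *[of f1 g2 f2 g1 h2 h1 g0 f0]) (auto simp: mult.commute)
    done
qed

lemma same_mapE:
  assumes "same_map (t0, t1, t2) (s0, s1, s2)"
  obtains u v where "u \<noteq> 0" "v \<noteq> 0" "u * t0 = v * s0" "u * t1 = v * s1" "u * t2 = v * s2"
proof -
  consider "s0 \<noteq> 0" | "s1 \<noteq> 0" | "s2 \<noteq> 0" using assms by auto
  then show thesis
  proof cases
    case 1
    then have "t0 \<noteq> 0" using assms by auto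
    with 1 assms show thesis by (intro that[of s0 t0]) (auto simp: mult.commute)
  next
    case 2
    then have "t1 \<noteq> 0" using assms by auto
    with 2 assms show thesis by (intro that[of s1 t1]) (auto simp: mult.commute)
  next
    case 3
    then have "t2 \<noteq> 0" using assms by auto
    with 3 assms show thesis by (intro that[of s2 t2]) (auto simp: mult.commute)
  qed
qed

lemma same_mapI:
  assumes "u \<noteq> 0" "v \<noteq> 0" "u * t0 = v * s0" "u * t1 = v * s1" "u * t2 = v * s2"
    "(t0, t1, t2) \<noteq> (0, 0, 0)"
  shows "same_map (t0, t1, t2) (s0, s1, s2)"
proof -
  have *: "a * y = b * x" if "u * a = v * x" "u * b = v * y" for a b x y
  proof -
    have "u * v * (a * y) = (u * a) * (v * y)" by (simp add: algebra_simps)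
    also have "\<dots> = (v * x) * (u * b)" using that by simp
    also have "\<dots> = u * v * (b * x)" by (simp add: algebra_simps)
    finally have "u * v * (a * y) = u * v * (b * x)" .
    then show ?thesis using assms(1,2) by simp
  qed
  have "(s0, s1, s2) \<noteq> (0, 0, 0)"
  proof
    assume "(s0, s1, s2) = (0, 0, 0)"
    then have "u * t0 = 0" "u * t1 = 0" "u * t2 = 0" using assms(3-5) by simp_all
    then show False using assms(1,6) by simp
  qed
  then show ?thesis unfolding same_map.simps
    using assms(6) *[OF assms(3,4)] *[OF assms(3,5)] *[OF assms(4,5)] by blast
qed

lemma same_map_substE:
  assumes "same_map t s"
  obtains u v where "u \<noteq> 0" "v \<noteq> 0"
    "\<And>d p. homog d p \<Longrightarrow> u ^ d * subst3 t p = v ^ d * subst3 s p"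
proof -
  obtain t0 t1 t2 s0 s1 s2 where eqs: "t = (t0, t1, t2)" "s = (s0, s1, s2)"
    by (metis prod_cases3)
  from same_mapE[OF assms[unfolded eqs]] obtain u v
    where uv: "u \<noteq> 0" "v \<noteq> 0" "u * t0 = v * s0" "u * t1 = v * s1" "u * t2 = v * s2" by metis
  show thesis
    by (rule that[of u v]) (use uv in \<open>simp_all add: eqs flip: subst3_scale\<close>)
qed

lemma vars_nz: "varX \<noteq> 0" "varY \<noteq> 0" "varZ \<noteq> 0"
  by (simp_all add: varX_def varY_def varZ_def)

lemma subst3_birational_nz:
  assumes "birational f" "homog d p" "p \<noteq> 0"
  shows "subst3 f p \<noteq> 0"
proof
  assume 0: "subst3 f p = 0"
  obtain g where g: "same_map (comp_triple f g) id_triple"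
    using assms(1) by (auto simp: birational_def)
  obtain u v where uv: "u \<noteq> 0" "v \<noteq> 0"
    "u ^ d * subst3 (comp_triple f g) p = v ^ d * subst3 id_triple p"
    using same_map_substE[OF g] assms(2) by metis
  have "subst3 (comp_triple f g) p = 0"
    using 0 by (simp add: rhomD(1)[OF rhom_subst3] flip: subst3_subst3)
  then show False using uv assms(3) by (simp add: subst3_id)
qed

lemma homog_comp:
  assumes "homog_triple d f" "homog_triple e g" "comp_triple f g \<noteq> (0, 0, 0)"
  shows "homog_triple (d * e) (comp_triple f g)"
  using assms by (cases f; cases g) (auto intro: homog_subst3)

lemma comp_birational_nz:
  assumes "homog_triple d f" "birational g" shows "comp_triple f g \<noteq> (0, 0, 0)"
  using assms subst3_birational_nz[OF assms(2)] by (cases f) auto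

lemma same_map_nz: "same_map f g \<Longrightarrow> f \<noteq> (0, 0, 0) \<and> g \<noteq> (0, 0, 0)"
  by (cases f; cases g) auto

lemma same_map_comp_left:
  assumes "same_map f f'" "comp_triple f g \<noteq> (0, 0, 0)" "comp_triple f' g \<noteq> (0, 0, 0)"
  shows "same_map (comp_triple f g) (comp_triple f' g)"
  using assms by (cases f; cases f') (auto simp flip: rhomD(4)[OF rhom_subst3])

lemma same_map_comp_right:
  assumes "same_map g g'" "homog_triple d f" "comp_triple f g \<noteq> (0, 0, 0)"
  shows "same_map (comp_triple f g) (comp_triple f g')"
proof -
  obtain f0 f1 f2 where eq: "f = (f0, f1, f2)" by (metis prod_cases3)
  obtain u v where uv: "u \<noteq> 0" "v \<noteq> 0"
    "\<And>d p. homog d p \<Longrightarrow> u ^ d * subst3 g p = v ^ d * subst3 g' p"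
    using same_map_substE[OF assms(1)] by metis
  show ?thesis unfolding eq comp_triple.simps
    by (rule same_mapI[of "u ^ d" "v ^ d"]) (use uv assms in \<open>auto simp: eq\<close>)
qed

lemma birationalE:
  assumes "birational f"
  obtains g d e where "homog_triple d f" "homog_triple e g" "birational g"
    "same_map (comp_triple f g) id_triple" "same_map (comp_triple g f) id_triple"
  using assms unfolding birational_def by blast

lemma birational_comp:
  assumes "birational f" "birational g" shows "birational (comp_triple f g)"
proof -
  obtain f' d d' where d: "homog_triple d f" and bf': "birational f'" and
    f': "homog_triple d' f'" "same_map (comp_triple f f') id_triple"
    "same_map (comp_triple f' f) id_triple" using assms(1) by (rule birationalE)
  obtain g' e e' where e: "homog_triple e g" and bg': "birational g'" and
    g': "homog_triple e' g'" "same_map (comp_triple g g') id_triple"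
    "same_map (comp_triple g' g) id_triple" using assms(2) by (rule birationalE)
  have *: "same_map (comp_triple (comp_triple a b) (comp_triple b' a')) id_triple"
    if "homog_triple n a" "homog_triple m b" "birational a" "birational b" "birational a'" "birational b'"
      "same_map (comp_triple a a') id_triple" "same_map (comp_triple b b') id_triple"
      "homog_triple n' a'"
    for a b a' b' n m n'
  proof -
    have hbb: "\<exists>k. homog_triple k (comp_triple b b')"
      using homog_comp[OF that(2) _ comp_birational_nz[OF that(2,6)]] that(6)
      unfolding birational_def by blast
    have nz: "comp_triple (comp_triple b b') a' \<noteq> (0, 0, 0)"
      using hbb comp_birational_nz[OF _ that(5)] by blast
    have 1: "same_map (comp_triple (comp_triple b b') a') (comp_triple id_triple a')"
      by (rule same_map_comp_left[OF that(8) nz]) (use that(9) in \<open>cases a'; auto simp: comp_id_left\<close>)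
    have nz2: "comp_triple a (comp_triple id_triple a') \<noteq> (0, 0, 0)"
      using same_map_nz[OF that(7)] by (simp add: comp_id_left)
    have "same_map (comp_triple a (comp_triple id_triple a'))
        (comp_triple a (comp_triple (comp_triple b b') a'))"
      by (rule same_map_comp_right[OF same_map_sym[OF 1] that(1) nz2])
    then show ?thesis
      using that(7) by (metis comp_id_left comp_triple_assoc same_map_sym same_map_trans)
  qed
  have 1: "same_map (comp_triple (comp_triple f g) (comp_triple g' f')) id_triple"
    using * d e assms bf' bg' f' g' by blast
  have 2: "same_map (comp_triple (comp_triple g' f') (comp_triple f g)) id_triple"
    using *[of e' g' d' f' g f e] d e assms bf' bg' f' g' by blast
  have "homog_triple (d * e) (comp_triple f g)"
    by (rule homog_comp[OF d e comp_birational_nz[OF d assms(2)]])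
  moreover have "homog_triple (e' * d') (comp_triple g' f')"
    by (rule homog_comp[OF g'(1) f'(1) comp_birational_nz[OF g'(1) bf']])
  ultimately show ?thesis using 1 2 unfolding birational_def by blast
qed

lemma birational_id: "birational id_triple"
proof -
  have "homog_triple 1 id_triple"
    by (simp add: id_triple_def homog_vars[simplified] vars_nz)
  moreover have "same_map id_triple id_triple"
    by (rule same_map_refl) (simp add: id_triple_def vars_nz)
  ultimately show ?thesis unfolding birational_def by (metis comp_id_left)
qed

section \<open>The group of birational self-maps\<close>

quotient_type bir = triple / partial: "\<lambda>f g. birational f \<and> birational g \<and> same_map f g"
  morphisms rep_bir abs_bir
proof (rule part_equivpI)
  show "\<exists>f. birational f \<and> birational f \<and> same_map f f"
  proof -
    have "same_map id_triple id_triple"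
      by (rule same_map_refl) (simp add: id_triple_def vars_nz)
    with birational_id show ?thesis by blast
  qed
  show "symp (\<lambda>f g. birational f \<and> birational g \<and> same_map f g)"
    by (auto intro!: sympI dest: same_map_sym)
  show "transp (\<lambda>f g. birational f \<and> birational g \<and> same_map f g)"
    by (auto intro!: transpI dest: same_map_trans)
qed

lemma birational_nz: "birational f \<Longrightarrow> f \<noteq> (0, 0, 0)"
  by (auto simp: birational_def)

lemma birational_same: "birational f \<Longrightarrow> same_map f f"
  by (simp add: birational_nz same_map_refl)

lemma comp_triple_cong:
  assumes "birational f" "birational f'" "birational g" "birational g'"
    "same_map f f'" "same_map g g'"
  shows "same_map (comp_triple f g) (comp_triple f' g')"
proof -
  have "same_map (comp_triple f g) (comp_triple f' g)"
    by (intro same_map_comp_left assms birational_nz birational_comp)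
  moreover obtain d where "homog_triple d f'" using assms(2) by (auto simp: birational_def)
  then have "same_map (comp_triple f' g) (comp_triple f' g')"
    by (intro same_map_comp_right assms birational_nz birational_comp)
  ultimately show ?thesis by (rule same_map_trans)
qed

instantiation bir :: monoid_mult
begin

lift_definition one_bir :: bir is id_triple
  by (simp add: birational_id birational_same)

text \<open>The product is composition: \<open>\<phi> * \<psi> = \<phi> \<circ> \<psi>\<close>, so that \<open>\<phi> ^ n\<close> is the \<open>n\<close>-th iterate.\<close>

lift_definition times_bir :: "bir \<Rightarrow> bir \<Rightarrow> bir" is comp_triple
  by (simp add: birational_comp comp_triple_cong)

instance
proof
  fix a b c :: bir
  show "a * b * c = a * (b * c)"
    by transfer (simp add: comp_triple_assoc birational_comp birational_same)
  show "1 * a = a" by transfer (simp add: comp_id_left)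
  show "a * 1 = a" by transfer (simp add: comp_id_right)
qed

end

lemma bir_inverse_exists: "\<exists>\<tau>. \<sigma> * \<tau> = 1 \<and> \<tau> * \<sigma> = (1 :: bir)"
proof (transfer, goal_cases)
  case (1 f)
  then have "birational f" by simp
  then obtain g d e where "birational g"
    and g: "same_map (comp_triple f g) id_triple" "same_map (comp_triple g f) id_triple"
    by (rule birationalE)
  with 1 g show ?case
    by (intro bexI[of _ g] conjI) (simp_all add: birational_comp birational_id birational_same
        del: same_map.simps comp_triple.simps split_paired_Ex)
qed

definition conjugate :: "bir \<Rightarrow> bir \<Rightarrow> bool" where
  "conjugate \<phi> \<psi> \<longleftrightarrow> (\<exists>\<sigma> \<tau>. \<sigma> * \<tau> = 1 \<and> \<tau> * \<sigma> = 1 \<and> \<psi> = \<sigma> * \<phi> * \<tau>)"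

definition bir_degree :: "bir \<Rightarrow> nat" where
  "bir_degree \<phi> = (THE d. \<exists>f. birational f \<and> abs_bir f = \<phi> \<and> homog_triple d f \<and> no_common_factor f)"

definition bounded_growth :: "bir \<Rightarrow> bool" where
  "bounded_growth \<phi> \<longleftrightarrow> (\<exists>N. \<forall>n. bir_degree (\<phi> ^ n) \<le> N)"

section \<open>Maps preserving the fibration fibre by fibre\<close>

text \<open>\<open>homogenize n A = Z\<^sup>n A(Y/Z)\<close>, for \<^term>\<open>degree A \<le> n\<close>.\<close>

definition homogenize :: "nat \<Rightarrow> complex poly \<Rightarrow> poly3" where
  "homogenize n A = (\<Sum>i\<le>n. cst (coeff A i) * varY ^ i * varZ ^ (n - i))"

text \<open>
  The affine chart is \<open>x = X/Z\<close>, \<open>y = Y/Z\<close>. The triple below is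
  \<open>((A(y) x + B(y)) / (C(y) x + D(y)), y)\<close> written in homogeneous coordinates, that is
  \<open>(A(y) x + B(y) : y (C(y) x + D(y)) : C(y) x + D(y))\<close> multiplied by \<open>Z\<^bsup>n+2\<^esup>\<close>;
  here \<open>n\<close> bounds the degrees of \<open>A\<close>, \<open>B\<close>, \<open>C\<close>, \<open>D\<close>.
\<close>

definition jonq_triple ::
  "nat \<Rightarrow> complex poly \<Rightarrow> complex poly \<Rightarrow> complex poly \<Rightarrow> complex poly \<Rightarrow> triple" where
  "jonq_triple n A B C D =
     (varZ * (homogenize n A * varX + homogenize n B * varZ),
      varY * (homogenize n C * varX + homogenize n D * varZ),
      varZ * (homogenize n C * varX + homogenize n D * varZ))"

definition jonq :: "complex poly \<Rightarrow> complex poly \<Rightarrow> complex poly \<Rightarrow> complex poly \<Rightarrow> bir" where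
  "jonq A B C D = abs_bir (jonq_triple (Max {degree A, degree B, degree C, degree D}) A B C D)"

text \<open>
  Clearing denominators, every element of \<open>PGL\<^sub>2(\<complex>(y))\<close> is represented by a matrix with entries
  in \<open>\<complex>[y]\<close> and nonzero determinant.
\<close>

definition J0 :: "bir set" where
  "J0 = {jonq A B C D | A B C D. A * D - B * C \<noteq> 0}"

text \<open>The Baum-Bott index; lemma \<open>baum_bott_jonq\<close> shows that it does not depend on the matrix.\<close>

definition baum_bott :: "bir \<Rightarrow> complex poly fract" where
  "baum_bott \<phi> = (THE \<beta>. \<exists>A B C D. A * D - B * C \<noteq> 0 \<and> \<phi> = jonq A B C D \<and>
     \<beta> = to_fract ((A + D)\<^sup>2) / to_fract (A * D - B * C))"

definition const_fract :: "complex \<Rightarrow> complex poly fract" where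
  "const_fract c = to_fract [:c:]"

text \<open>\<open>(x + a(y), y)\<close> with \<open>a = p/q\<close> in \<open>\<complex>(y)\<close>.\<close>

definition type_a :: "bir \<Rightarrow> bool" where
  "type_a \<psi> \<longleftrightarrow> (\<exists>p q. q \<noteq> 0 \<and> \<psi> = jonq q p 0 q)"

text \<open>\<open>(b x, y)\<close> with \<open>b\<close> a nonzero constant.\<close>

definition linear_type_b :: "bir \<Rightarrow> bool" where
  "linear_type_b \<psi> \<longleftrightarrow> (\<exists>b. b \<noteq> 0 \<and> \<psi> = jonq [:b:] 0 0 1)"

text \<open>\<open>(F(y)/x, y)\<close>, the case \<open>c = 0\<close> of type c: \<open>((c(y) x + F(y)) / (x + c(y)), y)\<close>.\<close>

definition involution_type_c :: "bir \<Rightarrow> bool" where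
  "involution_type_c \<psi> \<longleftrightarrow> (\<exists>F. \<not> (\<exists>G. F = G\<^sup>2) \<and> \<psi> = jonq 0 F 1 0)"

subsection \<open>Well-definedness\<close>

lemma cst_rules: "cst 0 = 0" "cst (x + y) = cst x + cst y" "cst (x * y) = cst x * cst y"
  "cst (- x) = - cst x"
  by (simp_all add: cst_def)

lemma homogenize_0: "homogenize n 0 = 0"
  by (simp add: homogenize_def cst_rules)

lemma homogenize_add: "homogenize n (A + B) = homogenize n A + homogenize n B"
  by (simp add: homogenize_def cst_rules algebra_simps sum.distrib)

lemma homogenize_minus: "homogenize n (- A) = - homogenize n A"
  by (simp add: homogenize_def cst_rules sum_negf)

lemma homogenize_sum: "homogenize n (sum f S) = (\<Sum>x\<in>S. homogenize n (f x))"
  by (induction S rule: infinite_finite_induct) (auto simp: homogenize_0 homogenize_add)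

lemma homogenize_monom:
  assumes "i \<le> n" shows "homogenize n (monom c i) = cst c * varY ^ i * varZ ^ (n - i)"
proof -
  have "homogenize n (monom c i) =
      (\<Sum>j\<le>n. if j = i then cst c * varY ^ i * varZ ^ (n - i) else 0)"
    unfolding homogenize_def by (intro sum.cong) (auto simp: cst_rules)
  then show ?thesis using assms by simp
qed

lemma homogenize_mult:
  assumes "degree A \<le> m" "degree B \<le> n"
  shows "homogenize (m + n) (A * B) = homogenize m A * homogenize n B"
proof -
  have "A * B = (\<Sum>i\<le>m. monom (coeff A i) i) * (\<Sum>j\<le>n. monom (coeff B j) j)"
    using assms by (simp add: poly_as_sum_of_monoms')
  also have "\<dots> = (\<Sum>i\<le>m. \<Sum>j\<le>n. monom (coeff A i * coeff B j) (i + j))"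
    by (simp only: sum_product mult_monom)
  finally have "homogenize (m + n) (A * B) =
      (\<Sum>i\<le>m. \<Sum>j\<le>n. homogenize (m + n) (monom (coeff A i * coeff B j) (i + j)))"
    by (simp only: homogenize_sum)
  also have "\<dots> = (\<Sum>i\<le>m. \<Sum>j\<le>n. (cst (coeff A i) * varY ^ i * varZ ^ (m - i)) *
      (cst (coeff B j) * varY ^ j * varZ ^ (n - j)))"
  proof (intro sum.cong refl)
    fix i j assume "i \<in> {..m}" "j \<in> {..n}"
    then have e: "m + n - (i + j) = (m - i) + (n - j)" and l: "i + j \<le> m + n" by auto
    show "homogenize (m + n) (monom (coeff A i * coeff B j) (i + j)) =
      (cst (coeff A i) * varY ^ i * varZ ^ (m - i)) * (cst (coeff B j) * varY ^ j * varZ ^ (n - j))"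
      unfolding homogenize_monom[OF l] e cst_rules power_add by (simp only: mult_ac)
  qed
  also have "\<dots> = homogenize m A * homogenize n B"
    by (simp only: homogenize_def sum_product)
  finally show ?thesis .
qed

lemma homog_homogenize: "homog n (homogenize n A)"
  unfolding homogenize_def
proof (intro homog_sum)
  fix i assume "i \<in> {..n}"
  have "homog (0 + i * 1 + (n - i) * 1) (cst (coeff A i) * varY ^ i * varZ ^ (n - i))"
    by (intro homog_mult homog_cst homog_power homog_vars)
  then show "homog n (cst (coeff A i) * varY ^ i * varZ ^ (n - i))"
    using \<open>i \<in> {..n}\<close> by simp
qed

lemma subst3_homogenize_scale:
  "subst3 (a, varY * w, varZ * w) (homogenize n A) = w ^ n * homogenize n A"
proof -
  have 1: "subst3 (a, b, c) (homogenize n A) = (\<Sum>i\<le>n. cst (coeff A i) * b ^ i * c ^ (n - i))"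
    for a b c
    by (simp add: homogenize_def rhom_sum[OF rhom_subst3] rhomD[OF rhom_subst3]
        rhom_power[OF rhom_subst3] subst3_cst subst3_vars)
  have 2: "cst c * (y * w) ^ i * (z * w) ^ (n - i) = w ^ n * (cst c * y ^ i * z ^ (n - i))"
    if "i \<le> n" for i c and y z :: poly3
  proof -
    have "(y * w) ^ i * (z * w) ^ (n - i) = (w ^ i * w ^ (n - i)) * (y ^ i * z ^ (n - i))"
      by (simp add: power_mult_distrib mult_ac)
    also have "w ^ i * w ^ (n - i) = w ^ n" using that by (simp flip: power_add)
    finally show ?thesis by (simp add: mult_ac)
  qed
  show ?thesis unfolding 1 unfolding homogenize_def sum_distrib_left
    by (intro sum.cong refl 2) simp
qed

text \<open>Setting \<open>Z = 1\<close>, with values in \<open>\<complex>[y][x]\<close>.\<close>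

definition dehom :: "poly3 \<Rightarrow> complex poly poly" where
  "dehom p = map_poly (map_poly (\<lambda>r. poly r 1)) p"

lemma rhom_dehom: "rhom dehom"
proof -
  have "rhom (\<lambda>r :: complex poly. poly r 1)" by (simp add: rhom_def)
  then show ?thesis unfolding dehom_def[abs_def] by (intro rhom_map_poly)
qed

lemma dehom_vars: "dehom varX = [:0, 1:]" "dehom varY = [:[:0, 1:]:]" "dehom varZ = 1"
    "dehom (cst c) = [:[:c:]:]"
  by (simp_all add: dehom_def varX_def varY_def varZ_def cst_def map_poly_pCons one_pCons)

lemma const_power: "[:p:] ^ i = [:p ^ i :: 'a::comm_ring_1:]"
  by (induction i) (simp_all add: one_pCons)

lemma dehom_homogenize:
  assumes "degree A \<le> n" shows "dehom (homogenize n A) = [:A:]"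
proof -
  have "dehom (homogenize n A) = (\<Sum>i\<le>n. [:monom (coeff A i) i:])"
    by (simp add: homogenize_def rhom_sum[OF rhom_dehom] rhomD[OF rhom_dehom]
        rhom_power[OF rhom_dehom] dehom_vars const_power monom_altdef)
  also have "\<dots> = [:\<Sum>i\<le>n. monom (coeff A i) i:]"
    by (rule rhom_sum[OF rhom_const, symmetric])
  finally show ?thesis using assms by (simp add: poly_as_sum_of_monoms')
qed

lemma dehom_linear:
  assumes "degree A \<le> n" "degree B \<le> n"
  shows "dehom (homogenize n A * varX + homogenize n B * varZ) = [:B, A:]"
  using assms by (simp add: rhomD[OF rhom_dehom] dehom_homogenize dehom_vars)

lemma linear_nz:
  assumes "degree A \<le> n" "degree B \<le> n" "A \<noteq> 0 \<or> B \<noteq> 0"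
  shows "homogenize n A * varX + homogenize n B * varZ \<noteq> 0"
  using dehom_linear[OF assms(1,2)] assms(3) rhomD(1)[OF rhom_dehom] by force

lemma homog_linear: "homog (n + 1) (homogenize n A * varX + homogenize n B * varZ)"
  by (intro homog_add homog_mult homog_homogenize homog_vars)

lemma jonq_triple_comp:
  assumes "degree A \<le> m" "degree B \<le> m" "degree C \<le> m" "degree D \<le> m"
    "degree A' \<le> n" "degree B' \<le> n" "degree C' \<le> n" "degree D' \<le> n"
  obtains k u v w where
    "k = varZ * (homogenize n C' * varX + homogenize n D' * varZ) ^ (m + 1)"
    "jonq_triple (m + n) (A * A' + B * C') (A * B' + B * D') (C * A' + D * C') (C * B' + D * D')
       = (u, v, w)"
    "comp_triple (jonq_triple m A B C D) (jonq_triple n A' B' C' D') = (k * u, k * v, k * w)"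
proof -
  define W where "W = homogenize n C' * varX + homogenize n D' * varZ"
  define U where "U = homogenize n A' * varX + homogenize n B' * varZ"
  let ?g = "(varZ * U, varY * W, varZ * W)"
  have h: "homogenize (m + n) (P * Q + R * S) =
      homogenize m P * homogenize n Q + homogenize m R * homogenize n S"
    if "degree P \<le> m" "degree Q \<le> n" "degree R \<le> m" "degree S \<le> n" for P Q R S
    using that by (simp add: homogenize_add homogenize_mult)
  have g: "jonq_triple n A' B' C' D' = ?g" by (simp add: jonq_triple_def U_def W_def)
  have s: "subst3 ?g (homogenize m P * varX + homogenize m Q * varZ) =
      W ^ m * varZ * (homogenize m P * U + homogenize m Q * W)" for P Q
    by (simp add: rhomD[OF rhom_subst3] subst3_vars subst3_homogenize_scale algebra_simps)
  have l: "homogenize m P * U + homogenize m Q * W =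
      (homogenize m P * homogenize n A' + homogenize m Q * homogenize n C') * varX +
      (homogenize m P * homogenize n B' + homogenize m Q * homogenize n D') * varZ" for P Q
    by (simp add: U_def W_def algebra_simps)
  let ?u = "homogenize m A * U + homogenize m B * W"
  let ?w = "homogenize m C * U + homogenize m D * W"
  show thesis
  proof (rule that[OF refl])
    show "jonq_triple (m + n) (A * A' + B * C') (A * B' + B * D') (C * A' + D * C')
        (C * B' + D * D') = (varZ * ?u, varY * ?w, varZ * ?w)"
      using assms by (simp add: jonq_triple_def h l)
    show "comp_triple (jonq_triple m A B C D) (jonq_triple n A' B' C' D') =
      (varZ * (homogenize n C' * varX + homogenize n D' * varZ) ^ (m + 1) * (varZ * ?u),
       varZ * (homogenize n C' * varX + homogenize n D' * varZ) ^ (m + 1) * (varY * ?w),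
       varZ * (homogenize n C' * varX + homogenize n D' * varZ) ^ (m + 1) * (varZ * ?w))"
      unfolding W_def[symmetric] unfolding g unfolding jonq_triple_def comp_triple.simps
        rhomD(4)[OF rhom_subst3, of _ varZ] rhomD(4)[OF rhom_subst3, of _ varY] subst3_vars s
      by (simp add: mult_ac)
  qed
qed

lemma jonq_triple_homog:
  assumes "degree A \<le> n" "degree B \<le> n" "degree C \<le> n" "degree D \<le> n"
    "A * D - B * C \<noteq> 0"
  shows "homog_triple (n + 2) (jonq_triple n A B C D)"
proof -
  have *: "homog (n + 2) (varZ * (homogenize n P * varX + homogenize n Q * varZ))"
    "homog (n + 2) (varY * (homogenize n P * varX + homogenize n Q * varZ))" for P Q
    using homog_mult[OF homog_vars(3) homog_linear[of n P Q]]
      homog_mult[OF homog_vars(2) homog_linear[of n P Q]] by simp_all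
  have "homogenize n C * varX + homogenize n D * varZ \<noteq> 0"
    using assms(5) by (intro linear_nz assms) auto
  then show ?thesis unfolding jonq_triple_def homog_triple.simps
    using * by (auto simp: vars_nz)
qed

lemma jonq_triple_inverse:
  assumes "degree A \<le> n" "degree B \<le> n" "degree C \<le> n" "degree D \<le> n"
    "A * D - B * C \<noteq> 0"
  shows "same_map (comp_triple (jonq_triple n A B C D) (jonq_triple n D (- B) (- C) A)) id_triple"
proof -
  have d: "degree (- B) \<le> n" "degree (- C) \<le> n" using assms by simp_all
  from jonq_triple_comp[OF assms(1-4) assms(4) d assms(1)]
  obtain k u v w where k: "k = varZ * (homogenize n (- C) * varX + homogenize n A * varZ) ^ (n + 1)"
    and uvw: "jonq_triple (n + n) (A * D + B * - C) (A * - B + B * A) (C * D + D * - C)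
        (C * - B + D * A) = (u, v, w)"
    and c: "comp_triple (jonq_triple n A B C D) (jonq_triple n D (- B) (- C) A) =
        (k * u, k * v, k * w)" .
  let ?d = "A * D - B * C"
  have "A * D + B * - C = ?d" "A * - B + B * A = 0" "C * D + D * - C = 0" "C * - B + D * A = ?d"
    by (simp_all add: mult_ac)
  with uvw have uvw': "jonq_triple (n + n) ?d 0 0 ?d = (u, v, w)" by (simp only:)
  have "degree ?d \<le> n + n"
    using assms degree_mult_le[of A D] degree_mult_le[of B C] by (intro degree_diff_le) linarith+
  then have "homogenize (n + n) ?d * varX + homogenize (n + n) 0 * varZ \<noteq> 0"
    using assms(5) by (intro linear_nz) auto
  then have hd: "homogenize (n + n) ?d \<noteq> 0" by (auto simp: homogenize_0)
  have "homogenize n (- C) * varX + homogenize n A * varZ \<noteq> 0"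
    using assms(5) by (intro linear_nz d assms) auto
  then have k0: "k \<noteq> 0" unfolding k by (simp add: vars_nz)
  have u: "u = varZ * homogenize (n + n) ?d * varX" "v = varZ * homogenize (n + n) ?d * varY"
    "w = varZ * homogenize (n + n) ?d * varZ"
    using uvw' by (auto simp: jonq_triple_def homogenize_0)
  show ?thesis unfolding c id_triple_def
    by (rule same_mapI[of 1 "k * (varZ * homogenize (n + n) ?d)"])
       (use hd k0 in \<open>simp_all add: u vars_nz mult_ac\<close>)
qed

lemma birational_jonq_triple:
  assumes "degree A \<le> n" "degree B \<le> n" "degree C \<le> n" "degree D \<le> n"
    "A * D - B * C \<noteq> 0"
  shows "birational (jonq_triple n A B C D)"
proof -
  have d: "degree (- B) \<le> n" "degree (- C) \<le> n" "D * A - (- B) * (- C) \<noteq> 0"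
    using assms by (simp_all add: mult_ac)
  show ?thesis unfolding birational_def
    using jonq_triple_homog[OF assms] jonq_triple_homog[OF assms(4) d(1,2) assms(1) d(3)]
      jonq_triple_inverse[OF assms] jonq_triple_inverse[OF assms(4) d(1,2) assms(1) d(3)]
    by (metis minus_minus)
qed

lemma abs_bir_eq_iff:
  assumes "birational f" "birational g"
  shows "abs_bir f = abs_bir g \<longleftrightarrow> same_map f g"
  using Quotient3_rel[OF Quotient3_bir, of f g] assms birational_same by simp

lemma jonq_eq_imp:
  assumes "A * D - B * C \<noteq> 0" "A' * D' - B' * C' \<noteq> 0" "jonq A B C D = jonq A' B' C' D'"
  shows "A * C' = C * A'" "A * D' + B * C' = C * B' + D * A'" "B * D' = D * B'"
proof -
  let ?n = "Max {degree A, degree B, degree C, degree D}"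
  let ?m = "Max {degree A', degree B', degree C', degree D'}"
  have n: "degree A \<le> ?n" "degree B \<le> ?n" "degree C \<le> ?n" "degree D \<le> ?n" by simp_all
  have m: "degree A' \<le> ?m" "degree B' \<le> ?m" "degree C' \<le> ?m" "degree D' \<le> ?m" by simp_all
  have "same_map (jonq_triple ?n A B C D) (jonq_triple ?m A' B' C' D')"
    using assms(3) unfolding jonq_def
    by (simp only: abs_bir_eq_iff[OF birational_jonq_triple[OF n assms(1)]
        birational_jonq_triple[OF m assms(2)]])
  then have "varZ * (homogenize ?n A * varX + homogenize ?n B * varZ) *
      (varZ * (homogenize ?m C' * varX + homogenize ?m D' * varZ)) =
      varZ * (homogenize ?n C * varX + homogenize ?n D * varZ) *
      (varZ * (homogenize ?m A' * varX + homogenize ?m B' * varZ))"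
    unfolding jonq_triple_def same_map.simps by blast
  then have "dehom (varZ * (homogenize ?n A * varX + homogenize ?n B * varZ) *
      (varZ * (homogenize ?m C' * varX + homogenize ?m D' * varZ))) =
      dehom (varZ * (homogenize ?n C * varX + homogenize ?n D * varZ) *
      (varZ * (homogenize ?m A' * varX + homogenize ?m B' * varZ)))" by (rule arg_cong)
  then have "[:B, A:] * [:D', C':] = [:D, C:] * [:B', A':]"
    unfolding rhomD(4)[OF rhom_dehom] dehom_linear[OF n(1,2)] dehom_linear[OF n(3,4)]
      dehom_linear[OF m(1,2)] dehom_linear[OF m(3,4)] dehom_vars by simp
  then show "A * C' = C * A'" "A * D' + B * C' = C * B' + D * A'" "B * D' = D * B'"
    by (simp_all add: algebra_simps)
qed

lemma baum_bott_jonq: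
  assumes "A * D - B * C \<noteq> 0"
  shows "baum_bott (jonq A B C D) = to_fract ((A + D)\<^sup>2) / to_fract (A * D - B * C)"
  unfolding baum_bott_def
proof (rule the_equality)
  show "\<exists>A' B' C' D'. A' * D' - B' * C' \<noteq> 0 \<and> jonq A B C D = jonq A' B' C' D' \<and>
      to_fract ((A + D)\<^sup>2) / to_fract (A * D - B * C) =
      to_fract ((A' + D')\<^sup>2) / to_fract (A' * D' - B' * C')"
    using assms by blast
next
  fix \<beta> assume "\<exists>A' B' C' D'. A' * D' - B' * C' \<noteq> 0 \<and> jonq A B C D = jonq A' B' C' D' \<and>
      \<beta> = to_fract ((A' + D')\<^sup>2) / to_fract (A' * D' - B' * C')"
  then obtain A' B' C' D' where nz: "A' * D' - B' * C' \<noteq> 0"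
    and eq: "jonq A B C D = jonq A' B' C' D'"
    and \<beta>: "\<beta> = to_fract ((A' + D')\<^sup>2) / to_fract (A' * D' - B' * C')" by blast
  note e = jonq_eq_imp[OF assms nz eq]
  define \<delta> \<mu> where "\<delta> = A * D - B * C" and "\<mu> = A * D' - C * B'"
  have "\<delta> * A' = \<mu> * A" "\<delta> * B' = \<mu> * B" "\<delta> * C' = \<mu> * C" "\<delta> * D' = \<mu> * D"
    using e unfolding \<delta>_def \<mu>_def by algebra+
  then have "\<delta>\<^sup>2 * ((A' + D')\<^sup>2 * \<delta>) = \<delta>\<^sup>2 * ((A + D)\<^sup>2 * (A' * D' - B' * C'))"
    unfolding \<delta>_def by algebra
  then have "(A' + D')\<^sup>2 * \<delta> = (A + D)\<^sup>2 * (A' * D' - B' * C')"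
    using assms by (simp add: \<delta>_def)
  then show "\<beta> = to_fract ((A + D)\<^sup>2) / to_fract (A * D - B * C)"
    unfolding \<beta> \<delta>_def using assms nz
    by (subst frac_eq_eq) (simp_all only: to_fract_eq_0_iff to_fract_mult[symmetric]
        not_False_eq_True)
qed

end

theory Submission
  imports Defs
begin

text \<open>
  Write \<open>\<phi>\<close> as the class of a matrix \<open>M\<close> over \<open>\<complex>[y]\<close> with trace \<open>t\<close> and determinant \<open>\<delta>\<close>, so
  that \<open>\<beta> = t\<^sup>2/\<delta>\<close> is its Baum-Bott index.

  If \<open>\<beta>\<close> is a nonzero constant, Cayley-Hamilton reads \<open>M\<^sup>2 = t (M - t/\<beta>)\<close>, so every power of
  \<open>M\<close> is proportional to a matrix \<open>a M + b t\<close> with constants \<open>a\<close>, \<open>b\<close>; if \<open>\<beta> = 0\<close>, then \<open>M\<^sup>2\<close> is a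
  scalar matrix. Either way the powers of \<open>\<phi>\<close> are given by matrices of bounded degree
  (\<open>bounded_growth_constant_index\<close>). The eigenvalues of \<open>M\<close> have a constant ratio, so they can be
  normalised explicitly: constant multiples of \<open>t\<close> if \<open>t \<noteq> 0\<close>, and the square roots of \<open>- \<delta>\<close> if
  \<open>t = 0\<close>. Distinct rational eigenvalues lead to \<open>(b x, y)\<close>, a double eigenvalue to
  \<open>(x + a(y), y)\<close>, and irrational square roots to \<open>(- \<delta>/x, y)\<close>
  (\<open>constant_index_normal_form\<close>).

  Conversely, the index of \<open>\<phi>\<^sup>2\<close> is \<open>(\<beta> - 2)\<^sup>2\<close>. The degree of a nonconstant rational function \<open>\<beta>\<close>
  doubles under \<open>\<beta> \<mapsto> (\<beta> - 2)\<^sup>2\<close>, so the indices of the maps \<open>\<phi>^(2^k)\<close> have unbounded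
  degree (\<open>index_height_doubles\<close>). On the other hand a map of degree at most \<open>N\<close> has a matrix with entries of
  degree at most \<open>N\<close> (\<open>jonq_low_degree_matrix\<close>), hence an index of degree at most \<open>2 N\<close>.

  Underlying all this is that a map has a representative without common factor, that this
  representative has the least degree, and that it is again homogeneous
  (\<open>bir_degree_representative\<close>).
\<close>

section \<open>Total degree and the degree of a plane birational map\<close>

lemma poly_monom_induct:
  fixes p :: "'a::comm_monoid_add poly"
  assumes "\<And>c n. P (monom c n)" "\<And>p q. P p \<Longrightarrow> P q \<Longrightarrow> P (p + q)"
  shows "P p"
proof -
  have "P (\<Sum>i\<in>A. monom (coeff p i) i)" for A
    by (induction A rule: infinite_finite_induct) (use assms assms(1)[of 0 0] in auto)
  from this[of "{..degree p}"] show ?thesis by (simp add: poly_as_sum_of_monoms)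
qed

lemma poly3_monom_induct:
  fixes p :: poly3
  assumes "\<And>c i j k. P (monom (monom (monom c k) j) i)" "\<And>p q. P p \<Longrightarrow> P q \<Longrightarrow> P (p + q)"
  shows "P p"
proof (induction p rule: poly_monom_induct)
  case (1 q i)
  show ?case
  proof (induction q rule: poly_monom_induct)
    case (1 r j)
    show ?case
      by (induction r rule: poly_monom_induct) (use assms in \<open>auto simp flip: add_monom\<close>)
  qed (use assms in \<open>auto simp flip: add_monom\<close>)
qed (use assms in auto)

lemma monom3_eq: "monom (monom (monom c k) j) i = cst c * varX ^ i * varY ^ j * varZ ^ k"
proof -
  have vars: "cst c = monom (monom (monom c 0) 0) 0" "varX = monom (monom (monom 1 0) 0) 1"
    "varY = monom (monom (monom 1 0) 1) 0" "varZ = monom (monom (monom 1 1) 0) 0"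
    by (simp_all add: cst_def varX_def varY_def varZ_def monom_0 monom_Suc one_pCons)
  show ?thesis unfolding vars monom_power mult_monom by simp
qed

text \<open>
  The substitution \<open>Y := X Y\<close>, \<open>Z := X Z\<close> turns the total degree of a monomial into its
  \<open>X\<close>-degree. Being a ring homomorphism into an integral domain, it transports
  additivity of the degree in one variable to the total degree, and shows that factors of
  homogeneous polynomials are homogeneous.
\<close>

definition radial :: "poly3 \<Rightarrow> poly3" where
  "radial = subst3 (varX, varX * varY, varX * varZ)"

lemma rhom_radial: "rhom radial"
  unfolding radial_def by (rule rhom_subst3)

lemma radial_monom:
  "radial (monom (monom (monom c k) j) i) = monom (monom (monom c k) j) (i + j + k)"
  unfolding monom3_eq
  by (simp add: radial_def rhomD[OF rhom_subst3] rhom_power[OF rhom_subst3] subst3_vars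
      subst3_cst power_mult_distrib power_add algebra_simps)

lemma coeff_radial:
  "coeff (coeff (coeff (radial p) n) j) k = (if j + k \<le> n then coeff (coeff (coeff p (n - j - k)) j) k else 0)"
proof (induction p rule: poly3_monom_induct)
  case (1 c a b d)
  show ?case by (auto simp: radial_monom)
next
  case (2 p q)
  then show ?case by (simp add: rhomD[OF rhom_radial])
qed

lemma poly3_eqI:
  assumes "\<And>i j k. coeff (coeff (coeff p i) j) k = coeff (coeff (coeff (q::poly3) i) j) k"
  shows "p = q"
  using assms by (intro poly_eqI)

lemma radial_eq_0_iff: "radial p = 0 \<longleftrightarrow> p = 0"
proof
  assume "radial p = 0"
  then have "coeff (coeff (coeff p i) j) k = 0" for i j k
    using coeff_radial[of p "i + j + k" j k] by simp
  then show "p = 0" by (intro poly3_eqI) simp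
qed (simp add: rhomD(1)[OF rhom_radial])

lemma homog_iff_radial: "homog d p \<longleftrightarrow> (\<exists>q. radial p = monom q d)"
proof
  assume h: "homog d p"
  have "coeff (radial p) n = 0" if "n \<noteq> d" for n
  proof -
    have "coeff (coeff (coeff p (n - j - k)) j) k = 0" if "j + k \<le> n" for j k
    proof -
      have "n - j - k + j + k \<noteq> d" using that \<open>n \<noteq> d\<close> by linarith
      then show ?thesis using h unfolding homog_def by blast
    qed
    then show ?thesis by (intro poly_eqI) (auto simp: coeff_radial)
  qed
  then have "radial p = monom (coeff (radial p) d) d"
    by (intro poly_eqI) auto
  then show "\<exists>q. radial p = monom q d" ..
next
  assume "\<exists>q. radial p = monom q d"
  then obtain q where q: "radial p = monom q d" ..
  show "homog d p" unfolding homog_def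
  proof (intro allI impI)
    fix i j k assume "coeff (coeff (coeff p i) j) k \<noteq> 0"
    then have "coeff (coeff (coeff (radial p) (i + j + k)) j) k \<noteq> 0"
      by (simp add: coeff_radial)
    then show "i + j + k = d" by (auto simp: q split: if_splits)
  qed
qed

definition total_degree :: "poly3 \<Rightarrow> nat" where
  "total_degree p = degree (radial p)"

lemma total_degree_mult:
  "p \<noteq> 0 \<Longrightarrow> q \<noteq> 0 \<Longrightarrow> total_degree (p * q) = total_degree p + total_degree q"
  by (simp add: total_degree_def rhomD[OF rhom_radial] degree_mult_eq radial_eq_0_iff)

lemma total_degree_homog: "homog d p \<Longrightarrow> p \<noteq> 0 \<Longrightarrow> total_degree p = d"
  unfolding homog_iff_radial total_degree_def
  by (metis degree_monom_eq monom_eq_0 radial_eq_0_iff)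

text \<open>
  The lowest and the highest coefficients of the factors multiply to nonzero coefficients of
  the product; when the product has only one coefficient, they coincide.
\<close>

lemma monom_factor:
  fixes p q :: "'a::idom poly"
  assumes "p * q = monom c d" "p \<noteq> 0" "q \<noteq> 0"
  shows "p = monom (lead_coeff p) (degree p)"
proof -
  define a where "a = (LEAST i. coeff p i \<noteq> 0)"
  define b where "b = (LEAST i. coeff q i \<noteq> 0)"
  have a: "coeff p a \<noteq> 0" "\<And>i. i < a \<Longrightarrow> coeff p i = 0"
    using assms(2) LeastI_ex[of "\<lambda>i. coeff p i \<noteq> 0"] not_less_Least[of _ "\<lambda>i. coeff p i \<noteq> 0"]
    unfolding a_def by (metis leading_coeff_0_iff)+
  have b: "coeff q b \<noteq> 0" "\<And>i. i < b \<Longrightarrow> coeff q i = 0"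
    using assms(3) LeastI_ex[of "\<lambda>i. coeff q i \<noteq> 0"] not_less_Least[of _ "\<lambda>i. coeff q i \<noteq> 0"]
    unfolding b_def by (metis leading_coeff_0_iff)+
  have "coeff (p * q) (a + b) = (\<Sum>i\<le>a + b. if i = a then coeff p a * coeff q b else 0)"
    unfolding coeff_mult
  proof (intro sum.cong refl)
    fix i assume "i \<in> {..a + b}"
    then consider "i < a" | "i = a" | "i > a" "a + b - i < b" by fastforce
    then show "coeff p i * coeff q (a + b - i) = (if i = a then coeff p a * coeff q b else 0)"
      by cases (auto simp: a b)
  qed
  then have "coeff (p * q) (a + b) \<noteq> 0" using a b by simp
  then have "a + b = d" by (auto simp: assms(1) split: if_splits)
  moreover have "degree p + degree q = d"
    using assms by (metis degree_monom_eq degree_mult_eq monom_eq_0 mult_eq_0_iff)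
  moreover have "a \<le> degree p" "b \<le> degree q" using a b by (auto intro: le_degree)
  ultimately have "a = degree p" by linarith
  then have "coeff p i = 0" if "i \<noteq> degree p" for i
    using that a(2) coeff_eq_0[of p i] by (metis nat_neq_iff)
  then show ?thesis by (intro poly_eqI) auto
qed

lemma homog_factor:
  assumes "homog d (p * q)" "p \<noteq> 0" "q \<noteq> 0"
  shows "homog (total_degree p) p"
  using assms monom_factor[of "radial p" "radial q"]
  unfolding homog_iff_radial[of d] homog_iff_radial[of _ p] total_degree_def
  by (metis radial_eq_0_iff rhomD(4)[OF rhom_radial])

text \<open>
  Dividing by the greatest common divisor leaves factors of homogeneous polynomials, which are
  homogeneous themselves.
\<close>

lemma exists_coprime_triple:
  assumes "homog_triple d f"
  obtains e f' where "homog_triple e f'" "no_common_factor f'" "same_map f f'"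
proof -
  obtain f0 f1 f2 where f: "f = (f0, f1, f2)" by (metis prod_cases3)
  define g where "g = gcd f0 (gcd f1 f2)"
  have hf: "homog d f0" "homog d f1" "homog d f2" "(f0, f1, f2) \<noteq> (0, 0, 0)"
    using assms by (simp_all add: f)
  have g0: "g \<noteq> 0" using hf(4) by (auto simp: g_def)
  have "g dvd f0" unfolding g_def by (rule gcd_dvd1)
  moreover have "g dvd f1" "g dvd f2" unfolding g_def by (meson dvd_trans gcd_dvd1 gcd_dvd2)+
  ultimately obtain a b c where abc: "f0 = g * a" "f1 = g * b" "f2 = g * c"
    by (metis dvdE)
  have h: "homog (d - total_degree g) p" if "homog d (g * p)" for p
  proof (cases "p = 0")
    case False
    then have "homog (total_degree p) p"
      using that g0 homog_factor[of d p g] by (simp add: mult.commute)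
    moreover have "d = total_degree g + total_degree p"
      using total_degree_homog[OF that] total_degree_mult[OF g0 False] False g0 by simp
    ultimately show ?thesis by simp
  qed simp
  show thesis
  proof (rule that)
    show "homog_triple (d - total_degree g) (a, b, c)"
      using hf h by (auto simp: abc)
    show "no_common_factor (a, b, c)" unfolding no_common_factor.simps
    proof (intro allI impI)
      fix k assume "k dvd a \<and> k dvd b \<and> k dvd c"
      then have "g * k dvd f0" "g * k dvd f1" "g * k dvd f2" by (auto simp: abc intro: mult_dvd_mono)
      then have "g * k dvd gcd f0 (gcd f1 f2)" by (intro gcd_greatest)
      then have "g * k dvd g" unfolding g_def[symmetric] .
      then show "is_unit k" using g0 dvd_times_left_cancel_iff[of g k 1] by simp
    qed
    show "same_map f (a, b, c)" unfolding f
      by (rule same_mapI[of 1 g]) (use g0 hf(4) in \<open>simp_all add: abc\<close>)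
  qed
qed

text \<open>Every triple proportional to a triple without common factor is a polynomial multiple of it.\<close>

lemma coprime_triple_degree_le:
  assumes "homog_triple d f" "no_common_factor f" "homog_triple e f'" "same_map f f'"
  shows "d \<le> e"
proof -
  obtain a b c where f: "f = (a, b, c)" by (metis prod_cases3)
  obtain a' b' c' where f': "f' = (a', b', c')" by (metis prod_cases3)
  obtain u v where uv: "u \<noteq> 0" "v \<noteq> 0" "u * a = v * a'" "u * b = v * b'" "u * c = v * c'"
    using same_mapE[OF assms(4)[unfolded f f']] by metis
  have unit: "is_unit (gcd a (gcd b c))"
    using assms(2) unfolding f no_common_factor.simps by (meson dvd_trans gcd_dvd1 gcd_dvd2)
  have "v dvd gcd (u * a) (gcd (u * b) (u * c))" by (simp add: uv)
  also have "\<dots> = normalize (u * gcd a (gcd b c))" by (simp add: gcd_mult_left)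
  finally have "v dvd u * gcd a (gcd b c)" by simp
  then have "v dvd u" using unit by (simp add: dvd_mult_unit_iff)
  then obtain w where w: "u = v * w" by (elim dvdE)
  then have eq: "a' = w * a" "b' = w * b" "c' = w * c" and w0: "w \<noteq> 0"
    using uv by (simp_all add: mult.assoc)
  obtain p where p: "p \<noteq> 0" "homog d p" "homog e (w * p)"
    using assms(1,3) unfolding f f' by (auto simp: eq)
  then have "e = total_degree w + d"
    using total_degree_homog[OF p(3)] total_degree_homog[OF p(2)] total_degree_mult[OF w0 p(1)] w0
    by simp
  then show ?thesis by simp
qed

lemma birational_same_map:
  assumes "birational f" "homog_triple e f'" "same_map f f'"
  shows "birational f'"
proof -
  obtain g d d' where g: "homog_triple d f" "homog_triple d' g" "birational g"
    "same_map (comp_triple f g) id_triple" "same_map (comp_triple g f) id_triple"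
    using assms(1) by (rule birationalE)
  have "same_map (comp_triple f g) (comp_triple f' g)"
    using assms(3) by (rule same_map_comp_left) (use assms g comp_birational_nz in blast)+
  moreover have "same_map (comp_triple g f) (comp_triple g f')"
    using assms(3) g(2) by (rule same_map_comp_right) (use assms(1) g comp_birational_nz in blast)
  ultimately show ?thesis
    using assms(2) g(2,4,5) unfolding birational_def by (metis same_map_sym same_map_trans)
qed

lemma birational_rep: "birational (rep_bir \<phi>)" "abs_bir (rep_bir \<phi>) = \<phi>"
  using Quotient3_rep_reflp[OF Quotient3_bir, of \<phi>] Quotient3_abs_rep[OF Quotient3_bir, of \<phi>]
  by auto

text \<open>
  Two representatives without common factor have the same degree, since each has the least
  degree; hence the description that defines \<open>bir_degree\<close> is satisfied by exactly one number.
\<close>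

lemma bir_degree_representative:
  obtains f where "birational f" "abs_bir f = \<phi>" "homog_triple (bir_degree \<phi>) f" "no_common_factor f"
proof -
  let ?P = "\<lambda>d f. birational f \<and> abs_bir f = \<phi> \<and> homog_triple d f \<and> no_common_factor f"
  have "\<exists>d. homog_triple d (rep_bir \<phi>)"
    using birational_rep(1)[of \<phi>] by (auto simp: birational_def)
  then obtain e f where f: "homog_triple e f" "no_common_factor f" "same_map (rep_bir \<phi>) f"
    using exists_coprime_triple by blast
  have b: "birational f" by (rule birational_same_map[OF birational_rep(1) f(1,3)])
  have P: "?P e f"
    using abs_bir_eq_iff[OF birational_rep(1) b, of \<phi>] f b by (simp add: birational_rep)
  have "bir_degree \<phi> = e" unfolding bir_degree_def
  proof (rule the_equality)
    show "\<exists>f. ?P e f" using P by blast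
    fix d assume "\<exists>f. ?P d f"
    then obtain f' where f': "?P d f'" by blast
    then have "same_map f f'" using P abs_bir_eq_iff by metis
    then show "d = e"
      using P f' coprime_triple_degree_le same_map_sym by (metis le_antisym)
  qed
  with P show thesis using that by blast
qed

lemma bir_degree_le:
  assumes "birational f" "homog_triple d f"
  shows "bir_degree (abs_bir f) \<le> d"
proof -
  obtain f' where f': "birational f'" "abs_bir f' = abs_bir f"
    "homog_triple (bir_degree (abs_bir f)) f'" "no_common_factor f'"
    using bir_degree_representative by metis
  then have "same_map f' f" using assms(1) by (simp add: abs_bir_eq_iff)
  then show ?thesis using coprime_triple_degree_le f' assms(2) by metis
qed

section \<open>Matrices and the maps they define\<close>

lemma homogenize_nz:
  assumes "degree A \<le> n" "A \<noteq> 0" shows "homogenize n A \<noteq> 0"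
  using assms dehom_homogenize[OF assms(1)] rhomD(1)[OF rhom_dehom] by force

text \<open>Homogenizing \<open>K A\<close> in a common degree in two ways gives the factors of proportionality.\<close>

lemma same_map_jonq_triple:
  assumes "degree A \<le> n" "degree B \<le> n" "degree C \<le> n" "degree D \<le> n"
    "degree (K * A) \<le> m" "degree (K * B) \<le> m" "degree (K * C) \<le> m" "degree (K * D) \<le> m"
    "A * D - B * C \<noteq> 0" "K \<noteq> 0"
  shows "same_map (jonq_triple n A B C D) (jonq_triple m (K * A) (K * B) (K * C) (K * D))"
proof -
  let ?k = "degree K"
  let ?u = "homogenize (?k + m) K" and ?v = "homogenize (n + ?k) 1"
  have *: "?u * homogenize n P = ?v * homogenize m (K * P)"
    if "degree P \<le> n" "degree (K * P) \<le> m" for P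
    using homogenize_mult[of K "?k + m" P n] homogenize_mult[of 1 "n + ?k" "K * P" m] that
    by (simp add: add_ac)
  have lin: "?u * (homogenize n P * varX + homogenize n Q * varZ) =
      ?v * (homogenize m (K * P) * varX + homogenize m (K * Q) * varZ)"
    if "degree P \<le> n" "degree (K * P) \<le> m" "degree Q \<le> n" "degree (K * Q) \<le> m" for P Q
    by (simp only: distrib_left mult.assoc[symmetric] *[OF that(1,2)] *[OF that(3,4)])
  have lin': "?u * (z * (homogenize n P * varX + homogenize n Q * varZ)) =
      ?v * (z * (homogenize m (K * P) * varX + homogenize m (K * Q) * varZ))"
    if "degree P \<le> n" "degree (K * P) \<le> m" "degree Q \<le> n" "degree (K * Q) \<le> m" for P Q z
    using lin[OF that] by (metis mult.left_commute)
  have nz: "jonq_triple n A B C D \<noteq> (0, 0, 0)"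
    using jonq_triple_homog[OF assms(1-4,9)] by (auto simp: jonq_triple_def)
  show ?thesis unfolding jonq_triple_def
  proof (rule same_mapI)
    show "?u \<noteq> 0" "?v \<noteq> 0" by (rule homogenize_nz; simp add: assms(10))+
  qed (rule lin'[OF assms(1,5,2,6)] lin'[OF assms(3,7,4,8)] nz[unfolded jonq_triple_def])+
qed

lemma abs_bir_jonq_triple:
  assumes "degree A \<le> n" "degree B \<le> n" "degree C \<le> n" "degree D \<le> n" "A * D - B * C \<noteq> 0"
  shows "abs_bir (jonq_triple n A B C D) = jonq A B C D"
proof -
  let ?m = "Max {degree A, degree B, degree C, degree D}"
  have m: "degree A \<le> ?m" "degree B \<le> ?m" "degree C \<le> ?m" "degree D \<le> ?m" by simp_all
  have "same_map (jonq_triple n A B C D) (jonq_triple ?m A B C D)"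
    by (rule same_map_jonq_triple[of A n B C D 1 ?m, unfolded mult_1, OF assms(1-4) m assms(5) one_neq_zero])
  then show ?thesis unfolding jonq_def
    by (simp only: abs_bir_eq_iff[OF birational_jonq_triple[OF assms] birational_jonq_triple[OF m assms(5)]])
qed

lemma jonq_scale:
  assumes "A * D - B * C \<noteq> 0" "K \<noteq> 0"
  shows "jonq (K * A) (K * B) (K * C) (K * D) = jonq A B C D"
proof -
  let ?n = "Max {degree A, degree B, degree C, degree D}"
  let ?m = "Max {degree (K * A), degree (K * B), degree (K * C), degree (K * D)}"
  have n: "degree A \<le> ?n" "degree B \<le> ?n" "degree C \<le> ?n" "degree D \<le> ?n" by simp_all
  have m: "degree (K * A) \<le> ?m" "degree (K * B) \<le> ?m" "degree (K * C) \<le> ?m" "degree (K * D) \<le> ?m"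
    by simp_all
  have "K * A * (K * D) - K * B * (K * C) = K * K * (A * D - B * C)" by (simp add: algebra_simps)
  then have d: "K * A * (K * D) - K * B * (K * C) \<noteq> 0"
    by (metis assms mult_eq_0_iff)
  show ?thesis unfolding jonq_def
    using same_map_sym[OF same_map_jonq_triple[OF n m assms]]
    by (simp only: abs_bir_eq_iff[OF birational_jonq_triple[OF m d] birational_jonq_triple[OF n assms(1)]])
qed

lemma abs_bir_mult:
  assumes "birational f" "birational g"
  shows "abs_bir f * abs_bir g = abs_bir (comp_triple f g)"
  using assms times_bir.abs_eq[of f g] birational_same by (simp add: eq_onp_def)

lemma abs_bir_comp_eq:
  assumes "birational f" "birational g" "comp_triple f g = (k * u, k * v, k * w)"
    "birational (u, v, w)"
  shows "abs_bir f * abs_bir g = abs_bir (u, v, w)"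
proof -
  have b: "birational (k * u, k * v, k * w)" using birational_comp assms(1-3) by metis
  have "same_map (u, v, w) (k * u, k * v, k * w)"
    using birational_nz[OF b] birational_nz[OF assms(4)] by (intro same_mapI[of k 1]) auto
  then show ?thesis
    using abs_bir_eq_iff[OF assms(4) b] abs_bir_mult[OF assms(1,2)] assms(3) by simp
qed

lemma det_mult:
  fixes A :: "'a::comm_ring_1"
  shows "(A * A' + B * C') * (C * B' + D * D') - (A * B' + B * D') * (C * A' + D * C')
    = (A * D - B * C) * (A' * D' - B' * C')"
  by (simp add: algebra_simps)

lemma jonq_mult:
  assumes "A * D - B * C \<noteq> 0" "A' * D' - B' * C' \<noteq> 0"
  shows "jonq A B C D * jonq A' B' C' D' =
    jonq (A * A' + B * C') (A * B' + B * D') (C * A' + D * C') (C * B' + D * D')"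
proof -
  let ?m = "Max {degree A, degree B, degree C, degree D}"
  let ?n = "Max {degree A', degree B', degree C', degree D'}"
  have m: "degree A \<le> ?m" "degree B \<le> ?m" "degree C \<le> ?m" "degree D \<le> ?m" by simp_all
  have n: "degree A' \<le> ?n" "degree B' \<le> ?n" "degree C' \<le> ?n" "degree D' \<le> ?n" by simp_all
  have deg: "degree (P * Q + R * S) \<le> ?m + ?n"
    if "degree P \<le> ?m" "degree Q \<le> ?n" "degree R \<le> ?m" "degree S \<le> ?n" for P Q R S :: "complex poly"
    using that degree_mult_le[of P Q] degree_mult_le[of R S]
    by (intro degree_add_le) linarith+
  note degs = deg[OF m(1) n(1) m(2) n(3)] deg[OF m(1) n(2) m(2) n(4)]
    deg[OF m(3) n(1) m(4) n(3)] deg[OF m(3) n(2) m(4) n(4)]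
  have det: "(A * A' + B * C') * (C * B' + D * D') - (A * B' + B * D') * (C * A' + D * C') \<noteq> 0"
    using assms by (simp add: det_mult)
  from jonq_triple_comp[OF m n] obtain k u v w where
    u: "jonq_triple (?m + ?n) (A * A' + B * C') (A * B' + B * D') (C * A' + D * C') (C * B' + D * D')
       = (u, v, w)"
    and c: "comp_triple (jonq_triple ?m A B C D) (jonq_triple ?n A' B' C' D') = (k * u, k * v, k * w)"
    by metis
  have "jonq A B C D * jonq A' B' C' D' = abs_bir (u, v, w)"
    unfolding jonq_def
    by (rule abs_bir_comp_eq[OF birational_jonq_triple[OF m assms(1)]
        birational_jonq_triple[OF n assms(2)] c])
       (use birational_jonq_triple[OF degs det] u in simp)
  then show ?thesis using abs_bir_jonq_triple[OF degs det] u by simp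
qed

lemma jonq_scalar:
  assumes "K \<noteq> 0" shows "jonq K 0 0 K = 1"
proof -
  have "same_map (jonq_triple 0 1 0 0 1) id_triple"
    unfolding jonq_triple_def id_triple_def
    by (rule same_mapI[of 1 varZ])
       (simp_all add: homogenize_0 homogenize_def vars_nz rhomD[OF rhom_cst] mult_ac)
  moreover have "birational (jonq_triple 0 1 0 0 1)" by (rule birational_jonq_triple) simp_all
  ultimately have "abs_bir (jonq_triple 0 1 0 0 1) = 1"
    unfolding one_bir.abs_eq using abs_bir_eq_iff birational_id by blast
  then have "jonq 1 0 0 1 = 1" using abs_bir_jonq_triple[of 1 0 0 0 1] by simp
  then show ?thesis using jonq_scale[of 1 1 0 0 K] assms by simp
qed

lemma bir_degree_jonq_le:
  assumes "degree A \<le> n" "degree B \<le> n" "degree C \<le> n" "degree D \<le> n" "A * D - B * C \<noteq> 0"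
  shows "bir_degree (jonq A B C D) \<le> n + 2"
  using bir_degree_le[OF birational_jonq_triple[OF assms] jonq_triple_homog[OF assms]]
  by (simp add: abs_bir_jonq_triple[OF assms])

text \<open>
  The hypotheses say \<open>S M' = M S\<close> for the matrices \<open>M = (A, B; C, D)\<close>, \<open>M' = (A', B'; C', D')\<close> and
  \<open>S = (a, b; c, d)\<close>: the columns of \<open>S\<close> are a basis in which \<open>M\<close> acts as \<open>M'\<close>.
\<close>

lemma conjugate_jonq:
  assumes "A * D - B * C \<noteq> 0" "a * d - b * c \<noteq> 0"
    "a * A' + b * C' = A * a + B * c" "a * B' + b * D' = A * b + B * d"
    "c * A' + d * C' = C * a + D * c" "c * B' + d * D' = C * b + D * d"
  shows "conjugate (jonq A B C D) (jonq A' B' C' D')"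
proof -
  define e where "e = a * d - b * c"
  let ?S = "jonq a b c d" and ?T = "jonq d (- b) (- c) a"
  have e0: "e \<noteq> 0" using assms(2) unfolding e_def .
  have "d * a - (- b) * (- c) = e" unfolding e_def by (simp only: minus_mult_minus mult.commute)
  with e0 have ad: "d * a - (- b) * (- c) \<noteq> 0" by (simp only: not_False_eq_True)
  have "a * d + b * - c = e" "a * - b + b * a = 0" "c * d + d * - c = 0" "c * - b + d * a = e"
    by (simp_all add: e_def mult_ac)
  then have st: "?S * ?T = 1"
    by (simp only: jonq_mult[OF assms(2) ad] jonq_scalar[OF e0])
  have "d * a + - b * c = e" "d * b + - b * d = 0" "- c * a + a * c = 0" "- c * b + a * d = e"
    by (simp_all add: e_def mult_ac)
  then have ts: "?T * ?S = 1"
    by (simp only: jonq_mult[OF ad assms(2)] jonq_scalar[OF e0])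
  have "(a * d - b * c) * (A' * D' - B' * C') = (A * D - B * C) * (a * d - b * c)"
    by (simp only: det_mult[symmetric] assms(3-6))
  then have det': "A' * D' - B' * C' \<noteq> 0" using assms(1,2) by auto
  have "?S * jonq A' B' C' D' = jonq A B C D * ?S"
    by (simp only: jonq_mult[OF assms(2) det'] jonq_mult[OF assms(1,2)] assms(3-6))
  then have "(?T * ?S) * jonq A' B' C' D' = ?T * jonq A B C D * ?S"
    by (simp only: mult.assoc)
  then have "jonq A' B' C' D' = ?T * jonq A B C D * ?S"
    by (simp only: ts mult_1)
  then show ?thesis unfolding conjugate_def using st ts by blast
qed

section \<open>A constant index forces bounded growth\<close>

lemma bounded_growthI:
  assumes "\<And>n. \<exists>A B C D. A * D - B * C \<noteq> 0 \<and> \<phi> ^ n = jonq A B C D \<and>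
    degree A \<le> N \<and> degree B \<le> N \<and> degree C \<le> N \<and> degree D \<le> N"
  shows "bounded_growth \<phi>"
  unfolding bounded_growth_def using assms bir_degree_jonq_le by metis

lemma jonq_trace_0_square:
  assumes "A * D - B * C \<noteq> 0" "A + D = 0"
  shows "jonq A B C D * jonq A B C D = 1"
proof -
  have D: "D = - A" using assms(2) by (simp add: eq_neg_iff_add_eq_0 add.commute)
  have eqs: "A * A + B * C = - (A * D - B * C)" "A * B + B * D = 0" "C * A + D * C = 0"
    "C * B + D * D = - (A * D - B * C)"
    by (simp_all add: D algebra_simps)
  have "- (A * D - B * C) \<noteq> 0" using assms(1) by (simp only: neg_equal_0_iff_equal not_False_eq_True)
  then show ?thesis
    unfolding jonq_mult[OF assms(1) assms(1)] eqs by (rule jonq_scalar)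
qed

text \<open>
  If \<open>\<delta> = k t\<^sup>2\<close> for the trace \<open>t\<close> and the determinant \<open>\<delta>\<close> of \<open>M\<close> then
  \<open>M\<^sup>2 = t (M - k t)\<close> by Cayley-Hamilton. Hence every power of \<open>M\<close> is, up to a power of \<open>t\<close>,
  a combination of \<open>M\<close> and \<open>t\<close> with constant coefficients.
\<close>

lemma jonq_power_constant_index:
  assumes det: "A * D - B * C \<noteq> 0" and t: "t = A + D" "t \<noteq> 0"
    and k: "A * D - B * C = k * t\<^sup>2" "degree k = 0"
  shows "\<exists>a b. degree a = 0 \<and> degree b = 0 \<and>
    (a * A + b * t) * (a * D + b * t) - (a * B) * (a * C) \<noteq> 0 \<and>
    jonq A B C D ^ n = jonq (a * A + b * t) (a * B) (a * C) (a * D + b * t)"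
proof (induction n)
  case 0
  show ?case using t jonq_scalar[OF t(2)] by (intro exI[of _ 0] exI[of _ 1]) simp
next
  case (Suc n)
  then obtain a b where ab: "degree a = 0" "degree b = 0"
    and nz: "(a * A + b * t) * (a * D + b * t) - (a * B) * (a * C) \<noteq> 0"
    and eq: "jonq A B C D ^ n = jonq (a * A + b * t) (a * B) (a * C) (a * D + b * t)" by blast
  define a' b' where "a' = a + b" and "b' = - (a * k)"
  have e: "A * (a * A + b * t) + B * (a * C) = t * (a' * A + b' * t)"
    "A * (a * B) + B * (a * D + b * t) = t * (a' * B)"
    "C * (a * A + b * t) + D * (a * C) = t * (a' * C)"
    "C * (a * B) + D * (a * D + b * t) = t * (a' * D + b' * t)"
    using k(1) unfolding a'_def b'_def t(1) by algebra+
  have "t * (a' * A + b' * t) * (t * (a' * D + b' * t)) - t * (a' * B) * (t * (a' * C)) =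
      (A * D - B * C) * ((a * A + b * t) * (a * D + b * t) - (a * B) * (a * C))"
    unfolding e[symmetric] by (rule det_mult)
  moreover have "t * (a' * A + b' * t) * (t * (a' * D + b' * t)) - t * (a' * B) * (t * (a' * C)) =
      t * t * ((a' * A + b' * t) * (a' * D + b' * t) - (a' * B) * (a' * C))"
    by (simp add: algebra_simps)
  ultimately have nz': "(a' * A + b' * t) * (a' * D + b' * t) - (a' * B) * (a' * C) \<noteq> 0"
    using det nz by (metis mult_eq_0_iff)
  have "jonq A B C D ^ Suc n = jonq (a' * A + b' * t) (a' * B) (a' * C) (a' * D + b' * t)"
    unfolding power_Suc eq jonq_mult[OF det nz] e by (rule jonq_scale[OF nz' t(2)])
  moreover have "degree a' = 0"
    using degree_add_le[of a 0 b] ab by (simp add: a'_def)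
  moreover have "degree b' = 0"
    using degree_mult_le[of a k] ab k(2) by (simp add: b'_def)
  ultimately show ?case using nz' by blast
qed

lemma bounded_growth_constant_index:
  assumes det: "A * D - B * C \<noteq> 0" and c: "(A + D)\<^sup>2 = [:c:] * (A * D - B * C)"
  shows "bounded_growth (jonq A B C D)"
proof (cases "A + D = 0")
  case True
  have "jonq A B C D ^ n = 1 \<or> jonq A B C D ^ n = jonq A B C D" for n
    by (induction n) (auto simp: jonq_trace_0_square[OF det True])
  then show ?thesis unfolding bounded_growth_def
    by (metis linear order_refl)
next
  case False
  define t where "t = A + D"
  define K where "K = Max {degree A, degree B, degree C, degree D, degree t}"
  have K: "degree A \<le> K" "degree B \<le> K" "degree C \<le> K" "degree D \<le> K" "degree t \<le> K"
    by (simp_all add: K_def)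
  have "c \<noteq> 0" using c False by auto
  then have "[:1 / c:] * [:c:] = 1" by (simp add: one_pCons)
  then have k: "A * D - B * C = [:1 / c:] * t\<^sup>2"
    unfolding t_def c by (metis mult.assoc mult_1)
  have deg: "degree (a * P) \<le> K" if "degree a = 0" "degree P \<le> K" for a P :: "complex poly"
    using degree_mult_le[of a P] that by simp
  show ?thesis
  proof (rule bounded_growthI)
    fix n
    obtain a b where "degree a = 0" "degree b = 0"
      "(a * A + b * t) * (a * D + b * t) - (a * B) * (a * C) \<noteq> 0"
      "jonq A B C D ^ n = jonq (a * A + b * t) (a * B) (a * C) (a * D + b * t)"
      using jonq_power_constant_index[OF det t_def False[folded t_def] k degree_pCons_0, of n]
      by (elim exE conjE) (rule that)
    then show "\<exists>A' B' C' D'. A' * D' - B' * C' \<noteq> 0 \<and> jonq A B C D ^ n = jonq A' B' C' D' \<and>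
      degree A' \<le> K \<and> degree B' \<le> K \<and> degree C' \<le> K \<and> degree D' \<le> K"
      by (intro exI conjI) (assumption | intro deg degree_add_le K)+
  qed
qed

section \<open>Normal forms for a constant index\<close>

lemma conjugate_diagonal:
  assumes det: "A * D - B * C \<noteq> 0"
    and l: "A + D = l1 + l2" "A * D - B * C = l1 * l2" "l1 \<noteq> l2"
  shows "conjugate (jonq A B C D) (jonq l1 0 0 l2)"
proof (cases "C = 0")
  case False
  \<comment> \<open>\<open>(l - D, C)\<close> is an eigenvector for the eigenvalue \<open>l\<close>\<close>
  have "(l1 - D) * C - (l2 - D) * C = (l1 - l2) * C" by (simp add: algebra_simps)
  then have "(l1 - D) * C - (l2 - D) * C \<noteq> 0" using False l(3) by simp
  then show ?thesis
    by (rule conjugate_jonq[OF det]) (use l(1,2) in algebra)+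
next
  case True
  then have "(l1 - A) * (l2 - A) = 0" using l(1,2) by algebra
  then consider "A = l1" | "A = l2" by auto
  then show ?thesis
  proof cases
    case 1
    then have D: "D = l2" using l(1) by simp
    have "1 * (D - A) - B * 0 \<noteq> 0" using l(3) 1 D by simp
    then show ?thesis
      by (rule conjugate_jonq[OF det]) (simp_all add: 1 D True algebra_simps)
  next
    case 2
    then have D: "D = l1" using l(1) by (simp add: add.commute)
    have "B * 0 - 1 * (D - A) \<noteq> 0" using l(3) 2 D by simp
    then show ?thesis
      by (rule conjugate_jonq[OF det]) (simp_all add: 2 D True algebra_simps)
  qed
qed

lemma linear_type_b_diagonal:
  assumes "a \<noteq> 0" "b \<noteq> 0" "e \<noteq> 0"
  shows "linear_type_b (jonq ([:a:] * e) 0 0 ([:b:] * e))"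
proof -
  have *: "[:a:] * e = ([:b:] * e) * [:a / b:]"
    using assms(2) by (simp add: mult.commute)
  have "jonq ([:a:] * e) 0 0 ([:b:] * e) = jonq [:a / b:] 0 0 1"
    using jonq_scale[of "[:a / b:]" 1 0 0 "[:b:] * e"] assms unfolding * by simp
  then show ?thesis unfolding linear_type_b_def using assms by (intro exI[of _ "a / b"]) simp
qed

lemma conjugate_parabolic:
  assumes det: "A * D - B * C \<noteq> 0" and l: "A + D = 2 * l" "A * D - B * C = l\<^sup>2"
  shows "\<exists>\<psi>. conjugate (jonq A B C D) \<psi> \<and> type_a \<psi>"
proof (cases "C = 0")
  case False
  have l0: "l \<noteq> 0" using det l(2) by auto
  \<comment> \<open>The first column is the image of \<open>(1, 0)\<close> under the nilpotent matrix \<open>M - l\<close>.\<close>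
  have "conjugate (jonq A B C D) (jonq l 1 0 l)"
  proof (rule conjugate_jonq[OF det])
    show "(A - l) * 0 - 1 * C \<noteq> 0" using False by simp
    show "C * l + 0 * 0 = C * (A - l) + D * C" "(A - l) * l + 1 * 0 = A * (A - l) + B * C"
      using l by algebra+
  qed (simp_all add: algebra_simps)
  then show ?thesis unfolding type_a_def using l0 by blast
next
  case True
  then have "(A - D)\<^sup>2 = 0" using l by algebra
  then have "A = D" by simp
  moreover have "conjugate (jonq A B C D) (jonq A B C D)"
    unfolding conjugate_def by (metis mult_1 mult_1_right)
  ultimately show ?thesis using True det unfolding type_a_def by (metis mult_eq_0_iff diff_zero mult_zero_right)
qed

lemma conjugate_involution:
  assumes det: "A * D - B * C \<noteq> 0" and t: "A + D = 0" and F: "\<not> (\<exists>G. - (A * D - B * C) = G\<^sup>2)"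
  shows "\<exists>\<psi>. conjugate (jonq A B C D) \<psi> \<and> involution_type_c \<psi>"
proof -
  have D: "D = - A" using t by (simp add: eq_neg_iff_add_eq_0 add.commute)
  have C: "C \<noteq> 0"
  proof
    assume "C = 0"
    then have "- (A * D - B * C) = A\<^sup>2" by (simp add: D power2_eq_square)
    then show False using F by blast
  qed
  \<comment> \<open>The basis consists of \<open>(1, 0)\<close> and its image, and \<open>M\<^sup>2\<close> is the scalar \<open>- det M\<close>.\<close>
  have "conjugate (jonq A B C D) (jonq 0 (- (A * D - B * C)) 1 0)"
  proof (rule conjugate_jonq[OF det])
    show "1 * C - A * 0 \<noteq> 0" using C by simp
  qed (simp_all add: D algebra_simps)
  then show ?thesis using F unfolding involution_type_c_def by blast
qed

text \<open>
  If the trace \<open>t\<close> is nonzero, the eigenvalues solve \<open>l\<^sup>2 - t l + t\<^sup>2/c = 0\<close> and are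
  therefore constant multiples of \<open>t\<close>. If \<open>t = 0\<close>, they are \<open>G\<close> and \<open>- G\<close> when
  \<open>- det M = G\<^sup>2\<close>, and otherwise not rational.
\<close>

lemma constant_index_normal_form:
  assumes det: "A * D - B * C \<noteq> 0" and c: "(A + D)\<^sup>2 = [:c:] * (A * D - B * C)"
  shows "\<exists>\<psi>. conjugate (jonq A B C D) \<psi> \<and> (type_a \<psi> \<or> linear_type_b \<psi> \<or> involution_type_c \<psi>)"
proof (cases "A + D = 0")
  case True
  show ?thesis
  proof (cases "\<exists>G. - (A * D - B * C) = G\<^sup>2")
    case F: True
    then obtain G where G: "- (A * D - B * C) = G\<^sup>2" by blast
    have G0: "G \<noteq> 0" using G det by auto
    have "A + D = [:1:] * G + [:-1:] * G" "A * D - B * C = ([:1:] * G) * ([:-1:] * G)"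
      using True G by (simp_all add: power2_eq_square equation_minus_iff)
    moreover have "[:1:] * G \<noteq> [:-1:] * G"
      using G0 by (simp add: eq_neg_iff_add_eq_0 flip: mult_2)
    ultimately have "conjugate (jonq A B C D) (jonq ([:1:] * G) 0 0 ([:-1:] * G))"
      by (rule conjugate_diagonal[OF det])
    moreover have "linear_type_b (jonq ([:1:] * G) 0 0 ([:-1:] * G))"
      by (rule linear_type_b_diagonal) (use G0 in auto)
    ultimately show ?thesis by blast
  next
    case False
    then show ?thesis using conjugate_involution[OF det True] by blast
  qed
next
  case False
  define t where "t = A + D"
  have t0: "t \<noteq> 0" using False by (simp add: t_def)
  have c0: "c \<noteq> 0" using c False by auto
  define s where "s = csqrt (1 - 4 / c)"
  define a b where "a = (1 + s) / 2" and "b = (1 - s) / 2"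
  have "s\<^sup>2 = 1 - 4 / c" by (simp add: s_def)
  then have ab: "a + b = 1" "a * b = 1 / c"
    by (simp_all add: a_def b_def field_simps power2_eq_square)
  have ab0: "a \<noteq> 0" "b \<noteq> 0" using ab(2) c0 by auto
  have "[:a:] * t + [:b:] * t = ([:a + b:]) * t" by (simp add: smult_add_left)
  then have sum: "A + D = [:a:] * t + [:b:] * t" by (simp add: ab t_def)
  have "([:a:] * t) * ([:b:] * t) = [:a * b:] * t\<^sup>2" by (simp add: power2_eq_square mult.commute)
  also have "\<dots> = [:1 / c:] * ([:c:] * (A * D - B * C))" unfolding ab t_def c ..
  also have "\<dots> = A * D - B * C" using c0 by simp
  finally have prod: "A * D - B * C = ([:a:] * t) * ([:b:] * t)" ..
  show ?thesis
  proof (cases "a = b")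
    case True
    have "A + D = 2 * ([:a:] * t)" "A * D - B * C = ([:a:] * t)\<^sup>2"
      using sum prod by (simp_all only: True mult_2 power2_eq_square)
    then show ?thesis using conjugate_parabolic[OF det] by blast
  next
    case False
    then have "[:a - b:] * t \<noteq> 0" using t0 by simp
    then have "[:a:] * t \<noteq> [:b:] * t" by (auto simp: smult_diff_left)
    then have "conjugate (jonq A B C D) (jonq ([:a:] * t) 0 0 ([:b:] * t))"
      by (rule conjugate_diagonal[OF det sum prod])
    then show ?thesis using linear_type_b_diagonal[OF ab0 t0] by blast
  qed
qed

section \<open>Bounded growth forces a constant index\<close>

text \<open>
  As \<open>A D - B C \<noteq> 0\<close>, the polynomials \<open>A x + B\<close> and \<open>C x + D\<close> have no common factor of positive
  degree in \<open>x\<close>. So the reduced form of \<open>p / q\<close> in \<open>\<complex>[y][x]\<close> arises from them by dividing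
  out a polynomial in \<open>y\<close>, and \<open>p\<close>, \<open>q\<close> arise from it by multiplying with a common factor.
\<close>

lemma reduce_linear_fraction:
  fixes p q :: "complex poly poly" and A B C D :: "complex poly"
  assumes det: "A * D - B * C \<noteq> 0" and pq: "p \<noteq> 0" "q \<noteq> 0" "p * [:D, C:] = q * [:B, A:]"
  obtains g h A' B' C' D' where "h \<noteq> 0" "A = h * A'" "B = h * B'" "C = h * C'" "D = h * D'"
    "p = g * [:B', A':]" "q = g * [:D', C':]"
proof -
  define g where "g = gcd p q"
  have g0: "g \<noteq> 0" using pq(1) by (simp add: g_def)
  obtain p' q' where p: "p = p' * g" and q: "q = q' * g" and cop: "coprime p' q'"
    using gcd_coprime_exists[of p q] g0 unfolding g_def by blast
  have p'0: "p' \<noteq> 0" using p pq(1) by auto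
  have "g * (p' * [:D, C:]) = g * (q' * [:B, A:])"
    using pq(3) unfolding p q by (simp only: mult_ac)
  then have eq: "p' * [:D, C:] = q' * [:B, A:]" using g0 by (simp only: mult_cancel_left simp_thms)
  then have "p' dvd q' * [:B, A:]" by (metis dvd_triv_left)
  then have "p' dvd [:B, A:]" using cop by (simp only: coprime_dvd_mult_right_iff)
  then obtain k where k: "[:B, A:] = p' * k" by (elim dvdE)
  have "p' * [:D, C:] = p' * (q' * k)" unfolding eq k by (simp only: mult_ac)
  then have k': "[:D, C:] = q' * k" using p'0 by (simp only: mult_cancel_left simp_thms)
  have AB: "[:B, A:] \<noteq> 0" "[:D, C:] \<noteq> 0" using det by auto
  have nz: "p' \<noteq> 0" "q' \<noteq> 0" "k \<noteq> 0" using AB k k' by auto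
  have deg: "degree p' + degree k \<le> 1" "degree q' + degree k \<le> 1"
    using degree_mult_eq[OF nz(1,3)] degree_mult_eq[OF nz(2,3)] degree_pCons_le[of B "[:A:]"]
      degree_pCons_le[of D "[:C:]"] unfolding k[symmetric] k'[symmetric] by simp_all
  have lin: "\<exists>a b. r = [:b, a:]" if "degree r \<le> 1" for r :: "complex poly poly"
  proof -
    have "r = [:coeff r 0, coeff r 1:]"
      by (intro poly_eqI) (use that in \<open>auto simp: coeff_pCons coeff_eq_0 split: nat.splits\<close>)
    then show ?thesis by blast
  qed
  have "degree k = 0"
  proof (rule ccontr)
    assume "degree k \<noteq> 0"
    then have "degree p' = 0" "degree q' = 0" using deg by linarith+
    then obtain a c where ac: "p' = [:a:]" "q' = [:c:]" by (metis degree_eq_zeroE)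
    obtain u v where "k = [:v, u:]" using lin[of k] deg by fastforce
    then have "A = a * u" "B = a * v" "C = c * u" "D = c * v" using k k' ac by simp_all
    then show False using det by (simp add: algebra_simps)
  qed
  then obtain h where h: "k = [:h:]" by (metis degree_eq_zeroE)
  obtain A' B' where p': "p' = [:B', A':]" using lin[of p'] deg by fastforce
  obtain C' D' where q': "q' = [:D', C':]" using lin[of q'] deg by fastforce
  show thesis
  proof (rule that)
    show "h \<noteq> 0" using nz(3) h by simp
    show "A = h * A'" "B = h * B'" "C = h * C'" "D = h * D'"
      using k k' unfolding p' q' h by (simp_all add: mult.commute)
    show "p = g * [:B', A':]" "q = g * [:D', C':]"
      unfolding p q p' q' by (simp_all only: mult.commute)
  qed
qed

text \<open>The bound is read off at two constant values of \<open>x\<close> at which \<open>p\<close> does not vanish.\<close>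

lemma degree_linear_factor_le:
  fixes p g :: "complex poly poly" and A B :: "complex poly"
  assumes "p = g * [:B, A:]" "p \<noteq> 0" "\<And>i. degree (coeff p i) \<le> N"
  shows "degree A \<le> N" "degree B \<le> N"
proof -
  have fin: "finite {s. poly p [:s:] = 0}"
  proof -
    have "finite ((\<lambda>s. [:s:]) -` {x. poly p x = 0})"
      by (rule finite_vimageI) (use poly_roots_finite[OF assms(2)] in \<open>auto simp: inj_on_def\<close>)
    then show ?thesis by (simp add: vimage_def)
  qed
  then obtain s where s: "poly p [:s:] \<noteq> 0"
    using infinite_UNIV_char_0[where 'a = complex] by (metis (mono_tags, lifting) UNIV_eq_I mem_Collect_eq)
  have "finite (insert s {s. poly p [:s:] = 0})" using fin by simp
  then obtain s' where s': "s' \<noteq> s" "poly p [:s':] \<noteq> 0"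
    using infinite_UNIV_char_0[where 'a = complex]
    by (metis (mono_tags, lifting) UNIV_eq_I insertCI mem_Collect_eq)
  have le: "degree (B + [:u:] * A) \<le> N" if "poly p [:u:] \<noteq> 0" for u
  proof -
    have "poly p [:u:] = (\<Sum>i\<le>degree p. smult (u ^ i) (coeff p i))"
      by (simp add: poly_altdef const_power mult.commute)
    also have "degree \<dots> \<le> N"
      by (intro degree_sum_le) (auto intro: order_trans[OF degree_smult_le] assms(3))
    finally have "degree (poly p [:u:]) \<le> N" .
    moreover have "poly p [:u:] = poly g [:u:] * (B + [:u:] * A)"
      by (simp add: assms(1) algebra_simps)
    ultimately show ?thesis using that by (auto simp: degree_mult_eq)
  qed
  have "degree ((B + [:s':] * A) - (B + [:s:] * A)) \<le> N"
    using le s s' by (intro degree_diff_le) auto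
  moreover have "(B + [:s':] * A) - (B + [:s:] * A) = smult (s' - s) A"
    by (simp add: smult_diff_left)
  ultimately show A: "degree A \<le> N" using s'(1) by simp
  have "degree ((B + [:s:] * A) - [:s:] * A) \<le> N"
    by (intro degree_diff_le le s) (use A degree_smult_le[of s A] in auto)
  then show "degree B \<le> N" by simp
qed

text \<open>
  Setting \<open>Z = 1\<close> loses nothing on homogeneous polynomials of degree \<open>d\<close>: the exponent of \<open>Z\<close> is
  \<open>d\<close> minus the other two.
\<close>

lemma dehom_homog:
  assumes "homog d p"
  shows "degree (coeff (dehom p) i) \<le> d" "dehom p = 0 \<longleftrightarrow> p = 0"
proof -
  have c: "coeff (coeff (dehom p) i) j = poly (coeff (coeff p i) j) 1" for i j
    by (simp add: dehom_def coeff_map_poly)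
  show "degree (coeff (dehom p) i) \<le> d"
  proof (rule degree_le, intro allI impI)
    fix j assume "d < j"
    then have "coeff (coeff (coeff p i) j) k = 0" for k
      using assms unfolding homog_def by (metis add.assoc add.commute not_add_less1)
    then have "coeff (coeff p i) j = 0" by (intro poly_eqI) simp
    then show "coeff (coeff (dehom p) i) j = 0" by (simp add: c)
  qed
  show "dehom p = 0 \<longleftrightarrow> p = 0"
  proof
    assume 0: "dehom p = 0"
    show "p = 0"
    proof (rule poly3_eqI)
      fix i j k
      define r where "r = coeff (coeff p i) j"
      have "coeff r m = 0" if "m \<noteq> d - i - j" for m
      proof (rule ccontr)
        assume "coeff r m \<noteq> 0"
        then have "i + j + m = d" using assms unfolding homog_def r_def by blast
        with that show False by simp
      qed
      then have "r = monom (coeff r (d - i - j)) (d - i - j)" by (intro poly_eqI) simp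
      then obtain e m where r: "r = monom e m" by blast
      have "poly r 1 = 0" using c[of i j] 0 by (simp add: r_def)
      then have "r = 0" by (simp add: r poly_monom)
      then show "coeff (coeff (coeff p i) j) k = coeff (coeff (coeff 0 i) j) k"
        by (simp add: r_def)
    qed
  qed (simp add: rhomD(1)[OF rhom_dehom])
qed

text \<open>
  A triple of degree at most \<open>N\<close> for the map gives, in the chart, a fraction \<open>p / q\<close> equal to
  \<open>(A x + B) / (C x + D)\<close> in which the degrees in \<open>y\<close> are at most \<open>N\<close>; reducing the fraction
  does not increase them.
\<close>

lemma jonq_low_degree_matrix:
  assumes det: "A * D - B * C \<noteq> 0" and N: "bir_degree (jonq A B C D) \<le> N"
  obtains A' B' C' D' where "A' * D' - B' * C' \<noteq> 0" "jonq A B C D = jonq A' B' C' D'"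
    "degree A' \<le> N" "degree B' \<le> N" "degree C' \<le> N" "degree D' \<le> N"
proof -
  let ?n = "Max {degree A, degree B, degree C, degree D}"
  have n: "degree A \<le> ?n" "degree B \<le> ?n" "degree C \<le> ?n" "degree D \<le> ?n" by simp_all
  define U W where "U = homogenize ?n A * varX + homogenize ?n B * varZ"
    and "W = homogenize ?n C * varX + homogenize ?n D * varZ"
  obtain f where f: "birational f" "abs_bir f = jonq A B C D"
    "homog_triple (bir_degree (jonq A B C D)) f"
    using bir_degree_representative by metis
  then have "same_map f (jonq_triple ?n A B C D)"
    unfolding jonq_def by (simp only: abs_bir_eq_iff[OF _ birational_jonq_triple[OF n det]])
  moreover obtain f0 f1 f2 where f012: "f = (f0, f1, f2)" by (metis prod_cases3)
  ultimately have "same_map (f0, f1, f2) (varZ * U, varY * W, varZ * W)"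
    unfolding jonq_triple_def U_def W_def by simp
  then have s: "(f0, f1, f2) \<noteq> (0, 0, 0)" "f0 * (varY * W) = f1 * (varZ * U)"
    "f0 * (varZ * W) = f2 * (varZ * U)"
    unfolding same_map.simps by blast+
  have U0: "U \<noteq> 0" unfolding U_def using det by (intro linear_nz n) auto
  have W0: "W \<noteq> 0" unfolding W_def using det by (intro linear_nz n) auto
  have f0: "f0 \<noteq> 0" using s U0 vars_nz by auto
  have f2: "f2 \<noteq> 0" using s(3) f0 W0 vars_nz by auto
  have h: "homog (bir_degree (jonq A B C D)) f0" "homog (bir_degree (jonq A B C D)) f2"
    using f(3) unfolding f012 by simp_all
  define p q where "p = dehom f0" and "q = dehom f2"
  have p: "p \<noteq> 0" "degree (coeff p i) \<le> N" and q: "q \<noteq> 0" "degree (coeff q i) \<le> N" for i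
    unfolding p_def q_def
    using dehom_homog(2)[OF h(1)] dehom_homog(1)[OF h(1), of i]
      dehom_homog(2)[OF h(2)] dehom_homog(1)[OF h(2), of i] f0 f2 N by auto
  have "dehom (f0 * (varZ * W)) = dehom (f2 * (varZ * U))" by (simp only: s(3))
  then have "p * [:D, C:] = q * [:B, A:]"
    unfolding rhomD(4)[OF rhom_dehom] U_def W_def dehom_linear[OF n(1,2)] dehom_linear[OF n(3,4)]
      dehom_vars p_def q_def by simp
  from reduce_linear_fraction[OF det p(1) q(1) this]
  obtain g k A' B' C' D' where k: "k \<noteq> 0" "A = k * A'" "B = k * B'" "C = k * C'" "D = k * D'"
    and pq: "p = g * [:B', A':]" "q = g * [:D', C':]" by metis
  have det': "A' * D' - B' * C' \<noteq> 0" using det unfolding k by (auto simp: algebra_simps)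
  have "jonq A B C D = jonq A' B' C' D'" unfolding k(2-5) by (rule jonq_scale[OF det' k(1)])
  then show thesis
    by (rule that[OF det']) (rule degree_linear_factor_le[OF pq(1) p] degree_linear_factor_le[OF pq(2) q])+
qed

text \<open>
  Squaring \<open>M\<close> replaces \<open>\<beta> = t\<^sup>2/\<delta>\<close> by \<open>(t\<^sup>2 - 2 \<delta>)\<^sup>2/\<delta>\<^sup>2 = (\<beta> - 2)\<^sup>2\<close>. For \<open>\<beta> = r/s\<close> in
  lowest terms this is \<open>(r - 2 s)\<^sup>2/s\<^sup>2\<close>, again in lowest terms, and the maximum of the two degrees doubles.
\<close>

lemma index_height_doubles:
  assumes det: "A * D - B * C \<noteq> 0"
    and rs: "coprime r s" "(A + D)\<^sup>2 * s = r * (A * D - B * C)" "0 < max (degree r) (degree s)"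
  shows "\<exists>A' B' C' D' r s. A' * D' - B' * C' \<noteq> 0 \<and> jonq A B C D ^ (2 ^ k) = jonq A' B' C' D' \<and>
    coprime r s \<and> (A' + D')\<^sup>2 * s = r * (A' * D' - B' * C') \<and> 2 ^ k \<le> max (degree r) (degree s)"
proof (induction k)
  case 0
  show ?case
    by (rule exI[of _ A], rule exI[of _ B], rule exI[of _ C], rule exI[of _ D], rule exI[of _ r],
        rule exI[of _ s]) (use det rs in auto)
next
  case (Suc k)
  then obtain A' B' C' D' r s where det': "A' * D' - B' * C' \<noteq> 0"
    and eq: "jonq A B C D ^ (2 ^ k) = jonq A' B' C' D'"
    and cop: "coprime r s" and i: "(A' + D')\<^sup>2 * s = r * (A' * D' - B' * C')"
    and m: "2 ^ k \<le> max (degree r) (degree s)" by blast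
  define a b c d where "a = A' * A' + B' * C'" and "b = A' * B' + B' * D'"
    and "c = C' * A' + D' * C'" and "d = C' * B' + D' * D'"
  have det2: "a * d - b * c = (A' * D' - B' * C') * (A' * D' - B' * C')"
    unfolding a_def b_def c_def d_def by (rule det_mult)
  have "jonq A B C D ^ (2 ^ Suc k) = jonq A' B' C' D' * jonq A' B' C' D'"
    by (simp only: power_Suc mult_2 power_add eq)
  then have eq2: "jonq A B C D ^ (2 ^ Suc k) = jonq a b c d"
    unfolding a_def b_def c_def d_def jonq_mult[OF det' det'] .
  have "gcd (r - 2 * s) s = gcd r s"
    using gcd_add_mult[of s "- 2" r] by (simp add: gcd.commute algebra_simps)
  then have cop2: "coprime ((r - 2 * s)\<^sup>2) (s\<^sup>2)"
    using cop by (simp add: coprime_iff_gcd_eq_1)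
  have "(a + d)\<^sup>2 * s\<^sup>2 = ((a + d) * s)\<^sup>2" by (simp add: power_mult_distrib)
  also have "(a + d) * s = (r - 2 * s) * (A' * D' - B' * C')"
    using i unfolding a_def d_def by algebra
  also have "\<dots>\<^sup>2 = (r - 2 * s)\<^sup>2 * (a * d - b * c)"
    by (simp only: det2 power2_eq_square mult_ac)
  finally have i2: "(a + d)\<^sup>2 * s\<^sup>2 = (r - 2 * s)\<^sup>2 * (a * d - b * c)" .
  have "2 ^ k \<le> max (degree (r - 2 * s)) (degree s)"
  proof (cases "2 ^ k \<le> degree s")
    case False
    have "2 * s = [:2:] * s" by (simp add: numeral_poly)
    then have "degree (2 * s) = degree s" by simp
    then have "degree (r - 2 * s) = degree r"
      using False m degree_add_eq_left[of "- (2 * s)" r] by simp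
    then show ?thesis using m by simp
  qed simp
  moreover have sq: "2 ^ Suc k \<le> degree (p\<^sup>2)" if "2 ^ k \<le> degree p" for p :: "complex poly"
    using that by (cases "p = 0") (auto simp: degree_power_eq)
  ultimately have m2: "2 ^ Suc k \<le> max (degree ((r - 2 * s)\<^sup>2)) (degree (s\<^sup>2))"
    using sq by (auto simp: le_max_iff_disj)
  show ?case
    by (rule exI[of _ a], rule exI[of _ b], rule exI[of _ c], rule exI[of _ d],
        rule exI[of _ "(r - 2 * s)\<^sup>2"], rule exI[of _ "s\<^sup>2"])
       (use det' det2 eq2 cop2 i2 m2 in simp)
qed

lemma index_unique:
  assumes "A * D - B * C \<noteq> 0" "A' * D' - B' * C' \<noteq> 0" "jonq A B C D = jonq A' B' C' D'"
  shows "(A + D)\<^sup>2 * (A' * D' - B' * C') = (A' + D')\<^sup>2 * (A * D - B * C)"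
proof -
  have "to_fract ((A + D)\<^sup>2) / to_fract (A * D - B * C) =
      to_fract ((A' + D')\<^sup>2) / to_fract (A' * D' - B' * C')"
    using baum_bott_jonq[OF assms(1)] baum_bott_jonq[OF assms(2)] assms(3) by simp
  moreover have "to_fract (A * D - B * C) \<noteq> 0" "to_fract (A' * D' - B' * C') \<noteq> 0"
    using assms(1,2) by (simp_all only: to_fract_eq_0_iff not_False_eq_True)
  ultimately have "to_fract ((A + D)\<^sup>2 * (A' * D' - B' * C')) = to_fract ((A' + D')\<^sup>2 * (A * D - B * C))"
    unfolding to_fract_mult by (metis frac_eq_eq)
  then show ?thesis by (simp only: to_fract_eq_iff)
qed

text \<open>In lowest terms \<open>r\<close> and \<open>s\<close> divide \<open>t\<^sup>2\<close> and \<open>\<delta>\<close> for every matrix of the map, also for one of low degree.\<close>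

lemma index_height_le:
  assumes det: "A * D - B * C \<noteq> 0" and N: "bir_degree (jonq A B C D) \<le> N"
    and rs: "coprime r s" "(A + D)\<^sup>2 * s = r * (A * D - B * C)"
  shows "max (degree r) (degree s) \<le> 2 * N"
proof -
  obtain a b c d where det': "a * d - b * c \<noteq> 0" and eq: "jonq A B C D = jonq a b c d"
    and deg: "degree a \<le> N" "degree b \<le> N" "degree c \<le> N" "degree d \<le> N"
    using jonq_low_degree_matrix[OF det N] by metis
  have "(A * D - B * C) * ((a + d)\<^sup>2 * s) = (a + d)\<^sup>2 * (A * D - B * C) * s"
    by (simp only: mult_ac)
  also have "\<dots> = (A + D)\<^sup>2 * (a * d - b * c) * s"
    by (simp only: index_unique[OF det det' eq])
  also have "\<dots> = (A * D - B * C) * (r * (a * d - b * c))"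
  proof -
    have "(A + D)\<^sup>2 * (a * d - b * c) * s = (A + D)\<^sup>2 * s * (a * d - b * c)"
      by (simp only: mult_ac)
    then show ?thesis unfolding rs(2) by (simp only: mult_ac)
  qed
  finally have i: "(a + d)\<^sup>2 * s = r * (a * d - b * c)"
    using det by (simp only: mult_cancel_left simp_thms)
  have "s dvd r * (a * d - b * c)" unfolding i[symmetric] by simp
  then have "s dvd a * d - b * c"
    using rs(1) by (simp add: coprime_dvd_mult_right_iff coprime_commute)
  then have "degree s \<le> degree (a * d - b * c)" using det' by (rule dvd_imp_degree_le)
  also have "\<dots> \<le> 2 * N"
    using degree_mult_le[of a d] degree_mult_le[of b c] deg by (intro degree_diff_le) linarith+
  finally have s: "degree s \<le> 2 * N" .
  have "degree r \<le> 2 * N"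
  proof (cases "a + d = 0")
    case True
    then have "r = 0" using i det' by simp
    then show ?thesis by simp
  next
    case False
    have "r dvd (a + d)\<^sup>2 * s" unfolding i by simp
    then have "r dvd (a + d)\<^sup>2" using rs(1) by (simp add: coprime_dvd_mult_left_iff)
    then have "degree r \<le> degree ((a + d)\<^sup>2)" using False by (intro dvd_imp_degree_le) simp_all
    also have "\<dots> \<le> 2 * N" using False degree_add_le[OF deg(1,4)] by (simp add: degree_power_eq)
    finally show ?thesis .
  qed
  with s show ?thesis by simp
qed

lemma constant_index_of_bounded_growth:
  assumes det: "A * D - B * C \<noteq> 0" and "bounded_growth (jonq A B C D)"
  shows "\<exists>c. (A + D)\<^sup>2 = [:c:] * (A * D - B * C)"
proof -
  obtain N where N: "bir_degree (jonq A B C D ^ n) \<le> N" for n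
    using assms(2) by (auto simp: bounded_growth_def)
  define g where "g = gcd ((A + D)\<^sup>2) (A * D - B * C)"
  have "g \<noteq> 0" using det by (simp add: g_def)
  then obtain r s where r: "(A + D)\<^sup>2 = r * g" and s: "A * D - B * C = s * g" and cop: "coprime r s"
    using gcd_coprime_exists[of "(A + D)\<^sup>2" "A * D - B * C"] unfolding g_def by blast
  have rs: "(A + D)\<^sup>2 * s = r * (A * D - B * C)" unfolding r s by (simp only: mult_ac)
  have "max (degree r) (degree s) = 0"
  proof (rule ccontr)
    assume "max (degree r) (degree s) \<noteq> 0"
    then have "0 < max (degree r) (degree s)" by (simp only: neq0_conv)
    from index_height_doubles[OF det cop rs this, of "2 * N"] obtain A' B' C' D' r' s' where
      det': "A' * D' - B' * C' \<noteq> 0" and eq: "jonq A B C D ^ (2 ^ (2 * N)) = jonq A' B' C' D'"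
      and rs': "coprime r' s'" "(A' + D')\<^sup>2 * s' = r' * (A' * D' - B' * C')"
      and m: "2 ^ (2 * N) \<le> max (degree r') (degree s')" by blast
    have "bir_degree (jonq A' B' C' D') \<le> N" unfolding eq[symmetric] by (rule N)
    from m index_height_le[OF det' this rs'] have "2 ^ (2 * N) \<le> 2 * N" by (rule order_trans)
    moreover have "2 * N < 2 ^ (2 * N)" by (rule less_exp)
    ultimately show False by (meson leD)
  qed
  then have "degree r = 0" "degree s = 0" by simp_all
  then obtain u v where uv: "r = [:u:]" "s = [:v:]" by (elim degree_eq_zeroE)
  have "v \<noteq> 0" using det unfolding s uv by auto
  then have "(A + D)\<^sup>2 = [:u / v:] * (A * D - B * C)" unfolding r s uv by simp
  then show ?thesis by blast
qed

section \<open>Bounded growth and the Baum-Bott index\<close>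

lemma baum_bott_constant_iff:
  assumes "A * D - B * C \<noteq> 0"
  shows "baum_bott (jonq A B C D) \<in> range const_fract \<longleftrightarrow>
    (\<exists>c. (A + D)\<^sup>2 = [:c:] * (A * D - B * C))"
proof -
  have nz: "to_fract (A * D - B * C) \<noteq> 0"
    using assms by (simp only: to_fract_eq_0_iff not_False_eq_True)
  have "to_fract ((A + D)\<^sup>2) / to_fract (A * D - B * C) = const_fract c \<longleftrightarrow>
      (A + D)\<^sup>2 = [:c:] * (A * D - B * C)" for c
    unfolding const_fract_def nonzero_divide_eq_eq[OF nz] to_fract_mult[symmetric] to_fract_eq_iff ..
  then show ?thesis unfolding baum_bott_jonq[OF assms] by (auto simp: image_iff)
qed

theorem mainTheorem4:
  fixes \<phi> :: bir
  assumes "\<phi> \<in> J0"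
  shows "(bounded_growth \<phi> \<longleftrightarrow> baum_bott \<phi> \<in> range const_fract) \<and>
    (bounded_growth \<phi> \<longrightarrow>
      (\<exists>\<psi>. conjugate \<phi> \<psi> \<and>
        (type_a \<psi> \<or> linear_type_b \<psi> \<or> involution_type_c \<psi>)))"
proof -
  obtain A B C D where det: "A * D - B * C \<noteq> 0" and \<phi>: "\<phi> = jonq A B C D"
    using assms unfolding J0_def by blast
  have "bounded_growth \<phi> \<longleftrightarrow> (\<exists>c. (A + D)\<^sup>2 = [:c:] * (A * D - B * C))"
    using constant_index_of_bounded_growth[OF det] bounded_growth_constant_index[OF det]
    unfolding \<phi> by blast
  then show ?thesis
    using baum_bott_constant_iff[OF det] constant_index_normal_form[OF det] unfolding \<phi> by blast
qed

end
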